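(* Let $S_1,S_2\subseteq\mathbb{Z}^{+}$ and let $r\ge 0$ be an integer. Let $D_{r,S_1,S_2}(n,k)$ be the number of $n\times k$ lonesum decomposable matrices of decomposition order $r$ such that the number of rows of the same type is contained in $S_1$ and the number of columns of the same type is contained in $S_2$, and let $D_{S_1,S_2}(n,k)$ be the number of $n\times k$ lonesum decomposable matrices (of any decomposition order) with the same restrictions. Then, as formal power series, $$\sum_{n=0}^{\infty}\sum_{k=0}^{\infty}D_{r,S_1,S_2}(n,k)\frac{x^n}{n!}\frac{y^k}{k!}=\frac{(1+E_{S_1}(x))(1+E_{S_2}(y))}{r!}\left(\frac{1}{1-E_{S_1}(x)E_{S_2}(y)}-1\right)^r,$$ and $$\sum_{n=0}^{\infty}\sum_{k=0}^{\infty}D_{S_1,S_2}(n,k)\frac{x^n}{n!}\frac{y^k}{k!}=(1+E_{S_1}(x))(1+E_{S_2}(y))\exp\left(\frac{1}{1-E_{S_1}(x)E_{S_2}(y)}-1\right).$$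
   Context: $\mathbb{Z}^{+}$ is the set of positive integers. For $S\subseteq\mathbb{Z}^{+}$, $E_S(x)=\sum_{s\in S}\frac{x^s}{s!}$. A lonesum matrix is a $(0,1)$-matrix that is uniquely determined, among $(0,1)$-matrices of the same size, by its row sum vector and column sum vector. A $(0,1)$-matrix is lonesum decomposable if by permuting its rows and/or columns it can be brought to block diagonal form $\mathrm{diag}(L_1,L_2,\dots,L_r)$, zeros outside the blocks, where each $L_i$ is a non-zero lonesum matrix; the number $r$ is uniquely determined by the matrix and is called its decomposition order. All-zero matrices (including empty ones) are lonesum decomposable of decomposition order $0$. Two rows (resp. columns) of a matrix have the same type if they coincide in every position; the restriction means: for every row occurring in the matrix (including an all-zero row), the number of rows of the same type belongs to $S_1$, and for every column occurring in it (including an all-zero column), the number of columns of the same type belongs to $S_2$. Convention for empty matrices: for each $n,k$ with $nk=0$ there is exactly one $n\times k$ matrix; all $n$ rows of an $n\times 0$ matrix are of the same (all-zero) type, and all $k$ columns of a $0\times k$ matrix are of the same (all-zero) type. *)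

theory Defs
  imports
    "HOL-Computational_Algebra.Formal_Power_Series"
    "HOL-Combinatorics.Permutations"
    "Jordan_Normal_Form.Matrix"
begin

section \<open>Lonesum and lonesum decomposable matrices\<close>

text \<open>
  Matrices carry their dimensions, so for \<open>n * k = 0\<close> the set \<open>carrier_mat n k\<close> has exactly one
  element, and the empty matrices of different dimensions are distinct.
\<close>

definition zero_one_mat :: "nat mat \<Rightarrow> bool" where
  "zero_one_mat A \<longleftrightarrow> elements_mat A \<subseteq> {0, 1}"

definition row_sum_vec :: "nat mat \<Rightarrow> nat vec" where
  "row_sum_vec A = vec (dim_row A) (\<lambda>i. \<Sum>j<dim_col A. A $$ (i, j))"

definition col_sum_vec :: "nat mat \<Rightarrow> nat vec" where
  "col_sum_vec A = vec (dim_col A) (\<lambda>j. \<Sum>i<dim_row A. A $$ (i, j))"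

definition lonesum_mat :: "nat mat \<Rightarrow> bool" where
  "lonesum_mat A \<longleftrightarrow> zero_one_mat A \<and>
     (\<forall>B \<in> carrier_mat (dim_row A) (dim_col A).
        zero_one_mat B \<and> row_sum_vec B = row_sum_vec A \<and> col_sum_vec B = col_sum_vec A
          \<longrightarrow> B = A)"

definition all_zero_mat :: "nat mat \<Rightarrow> bool" where
  "all_zero_mat A \<longleftrightarrow> A = 0\<^sub>m (dim_row A) (dim_col A)"

definition permute_mat :: "(nat \<Rightarrow> nat) \<Rightarrow> (nat \<Rightarrow> nat) \<Rightarrow> nat mat \<Rightarrow> nat mat" where
  "permute_mat p q A = mat (dim_row A) (dim_col A) (\<lambda>(i, j). A $$ (p i, q j))"

text \<open>
  The blocks need not be square, and they may contain zero rows and columns; they fill the whole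
  permuted matrix.
\<close>

definition lonesum_decomposition :: "nat mat list \<Rightarrow> nat mat \<Rightarrow> bool" where
  "lonesum_decomposition Ls A \<longleftrightarrow>
     (\<forall>L \<in> set Ls. lonesum_mat L \<and> \<not> all_zero_mat L) \<and>
     (\<exists>p q. p permutes {..<dim_row A} \<and> q permutes {..<dim_col A} \<and>
        permute_mat p q A = diag_block_mat Ls)"

text \<open>
  All-zero matrices need a separate clause: the block diagonal matrix with no blocks
  is only the \<open>0 \<times> 0\<close> matrix.
\<close>

definition lonesum_decomposable :: "nat mat \<Rightarrow> bool" where
  "lonesum_decomposable A \<longleftrightarrow>
     zero_one_mat A \<and> (all_zero_mat A \<or> (\<exists>Ls. lonesum_decomposition Ls A))"

definition decomposition_order :: "nat mat \<Rightarrow> nat" where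
  "decomposition_order A =
     (if all_zero_mat A then 0
      else (THE r. \<exists>Ls. length Ls = r \<and> lonesum_decomposition Ls A))"


section \<open>Restrictions on the multiplicities of rows and columns\<close>

definition row_multiplicities_in :: "nat set \<Rightarrow> nat mat \<Rightarrow> bool" where
  "row_multiplicities_in S A \<longleftrightarrow>
     (\<forall>i < dim_row A. card {i'. i' < dim_row A \<and> row A i' = row A i} \<in> S)"

definition col_multiplicities_in :: "nat set \<Rightarrow> nat mat \<Rightarrow> bool" where
  "col_multiplicities_in S A \<longleftrightarrow>
     (\<forall>j < dim_col A. card {j'. j' < dim_col A \<and> col A j' = col A j} \<in> S)"

definition D_all :: "nat set \<Rightarrow> nat set \<Rightarrow> nat \<Rightarrow> nat \<Rightarrow> nat" where
  "D_all S1 S2 n k = card {A \<in> carrier_mat n k. lonesum_decomposable A \<and>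
     row_multiplicities_in S1 A \<and> col_multiplicities_in S2 A}"

definition D_order :: "nat \<Rightarrow> nat set \<Rightarrow> nat set \<Rightarrow> nat \<Rightarrow> nat \<Rightarrow> nat" where
  "D_order r S1 S2 n k = card {A \<in> carrier_mat n k. lonesum_decomposable A \<and>
     decomposition_order A = r \<and> row_multiplicities_in S1 A \<and> col_multiplicities_in S2 A}"


section \<open>Bivariate formal power series\<close>

text \<open>
  The ring \<open>\<rat>[[x, y]]\<close> is represented as \<open>\<rat>[[x]][[y]]\<close>, i.e. as the type \<open>rat fps fps\<close>: the outer
  variable is \<open>y\<close> and the coefficient of \<open>y\<^sup>k\<close> is a power series in \<open>x\<close>.
\<close>

definition egf2 :: "(nat \<Rightarrow> nat \<Rightarrow> nat) \<Rightarrow> rat fps fps" where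
  "egf2 a = Abs_fps (\<lambda>k. Abs_fps (\<lambda>n. of_nat (a n k) / (fact n * fact k)))"

definition E :: "nat set \<Rightarrow> rat fps" where
  "E S = Abs_fps (\<lambda>s. if s \<in> S then 1 / fact s else 0)"

definition in_x :: "rat fps \<Rightarrow> rat fps fps" where
  "in_x f = fps_const f"

definition in_y :: "rat fps \<Rightarrow> rat fps fps" where
  "in_y f = Abs_fps (\<lambda>k. fps_const (fps_nth f k))"

definition const2 :: "rat \<Rightarrow> rat fps fps" where
  "const2 c = fps_const (fps_const c)"

lemma fps_mult_inverse_unit:
  fixes f :: "rat fps fps"
  assumes "fps_nth f 0 = 1"
  shows "f * inverse f = 1"
proof -
  have "f * fps_right_inverse f (inverse (fps_nth f 0)) = 1"
    by (rule fps_right_inverse) (simp only: assms fps_inverse_one' inverse_1 mult_1)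
  then show ?thesis
    by (simp only: fps_inverse_def)
qed

text \<open>
  If \<open>0 \<notin> S2\<close>, then \<open>1 - E\<^bsub>S1\<^esub>(x) E\<^bsub>S2\<^esub>(y)\<close> is a unit, \<^const>\<open>inverse\<close> yields its inverse, and
  \<open>1 / (1 - E\<^bsub>S1\<^esub>(x) E\<^bsub>S2\<^esub>(y)) - 1\<close> has no term free of \<open>y\<close>, so that it may be substituted into
  another series with \<^const>\<open>fps_compose\<close>.
\<close>

lemma nth_0_denominator:
  assumes "0 \<notin> S2"
  shows "fps_nth (1 - in_x (E S1) * in_y (E S2)) 0 = 1"
proof -
  have "fps_nth (in_y (E S2)) 0 = 0"
    using assms by (simp add: in_y_def E_def)
  then show ?thesis
    by simp
qed

lemma denominator_mult_inverse:
  assumes "0 \<notin> S2"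
  shows "(1 - in_x (E S1) * in_y (E S2)) * inverse (1 - in_x (E S1) * in_y (E S2)) = 1"
  by (rule fps_mult_inverse_unit) (rule nth_0_denominator[OF assms])

lemma nth_0_inverse_minus_1:
  assumes "0 \<notin> S2"
  shows "fps_nth (inverse (1 - in_x (E S1) * in_y (E S2)) - 1) 0 = 0"
proof -
  have "fps_nth (inverse (1 - in_x (E S1) * in_y (E S2))) 0 =
      inverse (fps_nth (1 - in_x (E S1) * in_y (E S2)) 0)"
    by (simp only: fps_inverse_def fps_nth_Abs_fps fps_right_inverse_constructor.simps)
  also have "\<dots> = 1"
    by (simp only: nth_0_denominator[OF assms] fps_inverse_one' inverse_1)
  finally show ?thesis
    by simp
qed

lemma fps_nth_exp_1: "fps_nth (fps_exp (1 :: rat fps)) m = fps_const (1 / fact m)"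
proof -
  have "(of_nat (fact m) :: rat fps) = fps_const (fact m)"
    by (metis fps_of_nat of_nat_fact)
  then show ?thesis
    by (simp add: fps_exp_def fps_divide_unit fps_const_inverse divide_inverse)
qed

end

theory Submission
  imports Defs
begin

text \<open>
  Up to permutations of rows and columns, a non-zero lonesum block is a staircase once its zero rows
  and columns are dropped: its row types and its column types are equally many, say \<open>m\<close>, and both
  are linearly ordered by inclusion.  So a matrix of decomposition order \<open>r\<close> with its components numbered by
  \<open>{..<r}\<close> is the same as a pair of labellings, of rows and of columns, by labels \<open>None\<close> (zero row
  or column) or \<open>Some (c, l)\<close> (component \<open>c\<close>, level \<open>l < m c\<close>) in which every label \<open>Some (c, l)\<close>
  occurs.  Rows have the same type iff they have the same label, hence the pairs of labellings with
  component sizes \<open>m\<close> have the generating function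
  \<open>(1 + E\<^bsub>S1\<^esub>(x)) (1 + E\<^bsub>S2\<^esub>(y)) (E\<^bsub>S1\<^esub>(x) E\<^bsub>S2\<^esub>(y))\<^bsup>m 0 + \<dots> + m (r - 1)\<^esup>\<close>.  Summing over \<open>m \<ge> 1\<close> gives
  the \<open>r\<close>-th power of the geometric series, and the matrix determines the labellings
  up to the \<open>r!\<close> renumberings of its components.
\<close>

section \<open>Labellings and staircase matrices\<close>

definition labels :: "nat \<Rightarrow> (nat \<Rightarrow> nat) \<Rightarrow> (nat \<times> nat) set" where
  "labels r m = (SIGMA c:{..<r}. {..<m c})"

text \<open>\<open>None\<close> may be absent, since zero rows are optional, whereas every
  \<open>Some\<close> label has to occur. Functions are extensional so that a labelling is
  determined by its values below \<open>n\<close> and can be counted.\<close>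

definition labelling :: "nat \<Rightarrow> nat \<Rightarrow> (nat \<Rightarrow> nat) \<Rightarrow> (nat \<Rightarrow> (nat \<times> nat) option) \<Rightarrow> bool" where
  "labelling n r m f \<longleftrightarrow>
     f \<in> {..<n} \<rightarrow>\<^sub>E insert None (Some ` labels r m) \<and> Some ` labels r m \<subseteq> f ` {..<n}"

text \<open>A row of level \<open>l\<close> meets the columns of its component of levels
  \<open>0\<close> to \<open>l\<close>. Hence row supports grow and column supports shrink with the
  level. The diagonal is included, so that a row and a column with the same label always
  meet.\<close>

fun entry :: "(nat \<times> nat) option \<Rightarrow> (nat \<times> nat) option \<Rightarrow> nat" where
  "entry (Some (c, l)) (Some (c', l')) = (if c = c' \<and> l' \<le> l then 1 else 0)"
| "entry None _ = 0"
| "entry _ None = 0"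

definition stair_mat :: "nat \<Rightarrow> nat \<Rightarrow> (nat \<Rightarrow> (nat \<times> nat) option) \<Rightarrow> (nat \<Rightarrow> (nat \<times> nat) option) \<Rightarrow> nat mat"
  where "stair_mat n k f g = mat n k (\<lambda>(i, j). entry (f i) (g j))"

lemma labels_iff [simp]: "(c, l) \<in> labels r m \<longleftrightarrow> c < r \<and> l < m c"
  by (simp add: labels_def)

lemma finite_labels [simp]: "finite (labels r m)"
  by (simp add: labels_def)

lemma labelling_bound:
  assumes "labelling n r m f" "i < n" "f i = Some (c, l)"
  shows "c < r" "l < m c"
proof -
  have "f i \<in> insert None (Some ` labels r m)"
    using assms(1,2) unfolding labelling_def by blast
  then show "c < r" "l < m c"
    using assms(3) by auto
qed

lemma labelling_surj:
  assumes "labelling n r m f" "c < r" "l < m c"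
  obtains i where "i < n" "f i = Some (c, l)"
proof -
  have "Some (c, l) \<in> f ` {..<n}"
    using assms unfolding labelling_def by force
  then show thesis
    using that by (metis imageE lessThan_iff)
qed

lemma labelling_ext:
  assumes "labelling n r m f" "labelling n r' m' f'" "\<And>i. i < n \<Longrightarrow> f i = f' i"
  shows "f = f'"
proof (rule extensionalityI)
  show "f \<in> extensional {..<n}" "f' \<in> extensional {..<n}"
    using assms(1,2) by (auto simp: labelling_def PiE_def)
qed (use assms(3) in simp)

lemma entry_None [simp]: "entry u None = 0"
  by (cases u) auto

lemma entry_le_1: "entry u v \<le> 1"
  by (cases "(u, v)" rule: entry.cases) auto

lemma entry_cases: "entry u v = 0 \<or> entry u v = 1"
  using entry_le_1[of u v] by linarith

lemma entry_eq_1_iff: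
  "entry u v = 1 \<longleftrightarrow> (\<exists>c l l'. u = Some (c, l) \<and> v = Some (c, l') \<and> l' \<le> l)"
  by (cases "(u, v)" rule: entry.cases) auto

lemma entry_eq_Suc_0_iff:
  "entry u v = Suc 0 \<longleftrightarrow> (\<exists>c l l'. u = Some (c, l) \<and> v = Some (c, l') \<and> l' \<le> l)"
  using entry_eq_1_iff by simp

lemma stair_mat_carrier [simp]: "stair_mat n k f g \<in> carrier_mat n k"
  by (simp add: stair_mat_def)

lemma dim_stair_mat [simp]: "dim_row (stair_mat n k f g) = n" "dim_col (stair_mat n k f g) = k"
  by (simp_all add: stair_mat_def)

lemma index_stair_mat [simp]:
  "i < n \<Longrightarrow> j < k \<Longrightarrow> stair_mat n k f g $$ (i, j) = entry (f i) (g j)"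
  by (simp add: stair_mat_def)

lemma zero_one_mat_iff:
  "zero_one_mat A \<longleftrightarrow> (\<forall>i<dim_row A. \<forall>j<dim_col A. A $$ (i, j) = 0 \<or> A $$ (i, j) = 1)"
proof (intro iffI allI impI)
  fix i j assume "zero_one_mat A" and "i < dim_row A" "j < dim_col A"
  then show "A $$ (i, j) = 0 \<or> A $$ (i, j) = 1"
    using elements_matI[of A "dim_row A" "dim_col A" i j] unfolding zero_one_mat_def by blast
next
  assume "\<forall>i<dim_row A. \<forall>j<dim_col A. A $$ (i, j) = 0 \<or> A $$ (i, j) = 1"
  then show "zero_one_mat A"
    unfolding zero_one_mat_def by (metis elements_matD insertI1 insertI2 subsetI)
qed

lemma zero_one_stair_mat: "zero_one_mat (stair_mat n k f g)"
  using entry_cases by (simp add: zero_one_mat_iff del: One_nat_def)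

lemma row_eq_iff:
  "i < dim_row A \<Longrightarrow> i' < dim_row A \<Longrightarrow>
     row A i = row A i' \<longleftrightarrow> (\<forall>j<dim_col A. A $$ (i, j) = A $$ (i', j))"
  by (auto simp: row_def vec_eq_iff)

lemma col_eq_iff:
  "j < dim_col A \<Longrightarrow> j' < dim_col A \<Longrightarrow>
     col A j = col A j' \<longleftrightarrow> (\<forall>i<dim_row A. A $$ (i, j) = A $$ (i, j'))"
  by (auto simp: col_def vec_eq_iff)

text \<open>A column with the label of row \<open>i\<close> meets row \<open>i\<close> and therefore
  row \<open>i'\<close>; this puts \<open>i'\<close> into the same component, at the same level or a
  higher one. Exchanging the two rows gives equality.\<close>

lemma entry_row_eqD:
  assumes g: "labelling k r m g" and f: "labelling n r m f" and i: "i < n" "i' < n"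
    and eq: "\<And>j. j < k \<Longrightarrow> entry (f i) (g j) = entry (f i') (g j)"
  shows "f i = f i'"
proof -
  have *: "\<exists>l'. f i' = Some (c, l') \<and> l \<le> l'"
    if "i < n" "i' < n" "\<And>j. j < k \<Longrightarrow> entry (f i) (g j) = entry (f i') (g j)" "f i = Some (c, l)"
    for i i' c l
  proof -
    from labelling_bound[OF f \<open>i < n\<close> that(4)] obtain j where j: "j < k" "g j = Some (c, l)"
      using labelling_surj[OF g] by metis
    then have "entry (f i') (g j) = 1"
      using that(3)[OF j(1)] that(4) by simp
    then show ?thesis
      using j by (auto simp: entry_eq_Suc_0_iff)
  qed
  show ?thesis
  proof (cases "f i")
    case None
    have "f i' = None"
    proof (rule ccontr)
      assume "f i' \<noteq> None"
      then obtain c l where "f i' = Some (c, l)"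
        by fastforce
      with *[OF i(2,1) eq[symmetric]] None show False
        by (metis option.distinct(1))
    qed
    with None show ?thesis by simp
  next
    case (Some z)
    obtain c l where z: "z = (c, l)" by (cases z)
    obtain l' where l': "f i' = Some (c, l')" "l \<le> l'"
      using *[OF i eq] Some z by metis
    obtain l'' where l'': "f i = Some (c, l'')" "l' \<le> l''"
      using *[OF i(2,1) eq[symmetric] l'(1)] by metis
    show ?thesis
      using Some z l' l'' by simp
  qed
qed

text \<open>Here a row with the label of column \<open>j\<close> serves as the test. It bounds the
  level of column \<open>j'\<close> from above, and exchanging the columns gives equality.\<close>

lemma entry_col_eqD:
  assumes f: "labelling n r m f" and g: "labelling k r m g" and j: "j < k" "j' < k"
    and eq: "\<And>i. i < n \<Longrightarrow> entry (f i) (g j) = entry (f i) (g j')"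
  shows "g j = g j'"
proof -
  have *: "\<exists>l'. g j' = Some (c, l') \<and> l' \<le> l"
    if "j < k" "j' < k" "\<And>i. i < n \<Longrightarrow> entry (f i) (g j) = entry (f i) (g j')" "g j = Some (c, l)"
    for j j' c l
  proof -
    from labelling_bound[OF g \<open>j < k\<close> that(4)] obtain i where i: "i < n" "f i = Some (c, l)"
      using labelling_surj[OF f] by metis
    then have "entry (f i) (g j') = 1"
      using that(3)[OF i(1)] that(4) by simp
    then show ?thesis
      using i by (auto simp: entry_eq_Suc_0_iff)
  qed
  show ?thesis
  proof (cases "g j")
    case None
    have "g j' = None"
    proof (rule ccontr)
      assume "g j' \<noteq> None"
      then obtain c l where "g j' = Some (c, l)"
        by fastforce
      with *[OF j(2,1) eq[symmetric]] None show False
        by (metis option.distinct(1))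
    qed
    with None show ?thesis by simp
  next
    case (Some z)
    obtain c l where z: "z = (c, l)" by (cases z)
    obtain l' where l': "g j' = Some (c, l')" "l' \<le> l"
      using *[OF j eq] Some z by metis
    obtain l'' where l'': "g j = Some (c, l'')" "l'' \<le> l'"
      using *[OF j(2,1) eq[symmetric] l'(1)] by metis
    show ?thesis
      using Some z l' l'' by simp
  qed
qed

lemma row_stair_mat_eq_iff:
  assumes "labelling n r m f" "labelling k r m g" "i < n" "i' < n"
  shows "row (stair_mat n k f g) i = row (stair_mat n k f g) i' \<longleftrightarrow> f i = f i'"
proof
  assume "row (stair_mat n k f g) i = row (stair_mat n k f g) i'"
  then have "\<forall>j<k. entry (f i) (g j) = entry (f i') (g j)"
    using assms(3,4) by (simp add: row_eq_iff)
  then show "f i = f i'"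
    using entry_row_eqD[OF assms(2,1,3,4)] by blast
qed (use assms(3,4) in \<open>simp add: row_eq_iff\<close>)

lemma col_stair_mat_eq_iff:
  assumes "labelling n r m f" "labelling k r m g" "j < k" "j' < k"
  shows "col (stair_mat n k f g) j = col (stair_mat n k f g) j' \<longleftrightarrow> g j = g j'"
proof
  assume "col (stair_mat n k f g) j = col (stair_mat n k f g) j'"
  then have "\<forall>i<n. entry (f i) (g j) = entry (f i) (g j')"
    using assms(3,4) by (simp add: col_eq_iff)
  then show "g j = g j'"
    using entry_col_eqD[OF assms] by blast
qed (use assms(3,4) in \<open>simp add: col_eq_iff\<close>)

section \<open>Row and column multiplicities as fibre sizes\<close>

definition fibres_in :: "nat set \<Rightarrow> nat \<Rightarrow> (nat \<Rightarrow> 'z) \<Rightarrow> bool" where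
  "fibres_in S n f \<longleftrightarrow> (\<forall>i<n. card {i'. i' < n \<and> f i' = f i} \<in> S)"

lemma row_multiplicities_stair_mat:
  assumes "labelling n r m f" "labelling k r m g"
  shows "row_multiplicities_in S (stair_mat n k f g) \<longleftrightarrow> fibres_in S n f"
proof -
  have "{i'. i' < n \<and> row (stair_mat n k f g) i' = row (stair_mat n k f g) i} =
      {i'. i' < n \<and> f i' = f i}" if "i < n" for i
    using row_stair_mat_eq_iff[OF assms _ that] by auto
  then show ?thesis
    by (simp add: row_multiplicities_in_def fibres_in_def)
qed

lemma col_multiplicities_stair_mat:
  assumes "labelling n r m f" "labelling k r m g"
  shows "col_multiplicities_in S (stair_mat n k f g) \<longleftrightarrow> fibres_in S k g"
proof -
  have "{j'. j' < k \<and> col (stair_mat n k f g) j' = col (stair_mat n k f g) j} =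
      {j'. j' < k \<and> g j' = g j}" if "j < k" for j
    using col_stair_mat_eq_iff[OF assms _ that] by auto
  then show ?thesis
    by (simp add: col_multiplicities_in_def fibres_in_def)
qed

section \<open>Labellings with the same matrix\<close>

definition relabel :: "(nat \<Rightarrow> nat) \<Rightarrow> (nat \<times> nat) option \<Rightarrow> (nat \<times> nat) option" where
  "relabel \<pi> = map_option (map_prod \<pi> id)"

lemma relabel_simps [simp]:
  "relabel \<pi> None = None" "relabel \<pi> (Some (c, l)) = Some (\<pi> c, l)"
  by (simp_all add: relabel_def)

text \<open>Induction on the level. The column labelled \<open>(c, Suc l)\<close> meets row
  \<open>i\<close> but misses a row \<open>i0\<close> of level \<open>l\<close>, while the column
  labelled \<open>(c, l)\<close> meets both and so keeps them in one component of the second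
  labelling. There row \<open>i\<close> must lie strictly above \<open>i0\<close>.\<close>

lemma row_le_level:
  assumes f: "labelling n r m f" and g: "labelling k r m g"
    and f': "labelling n r' m' f'" and g': "labelling k r' m' g'"
    and eq: "\<And>i j. i < n \<Longrightarrow> j < k \<Longrightarrow> entry (f i) (g j) = entry (f' i) (g' j)"
    and "i < n" "f i = Some (c, l)"
  shows "\<exists>c' l'. f' i = Some (c', l') \<and> l \<le> l'"
  using \<open>i < n\<close> \<open>f i = Some (c, l)\<close>
proof (induction l arbitrary: i)
  case 0
  from labelling_bound[OF f this] obtain j where j: "j < k" "g j = Some (c, 0)"
    using labelling_surj[OF g] by metis
  then have "entry (f' i) (g' j) = 1"
    using eq[OF 0(1) j(1)] 0 by simp
  then show ?case by (auto simp: entry_eq_Suc_0_iff)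
next
  case (Suc l)
  have b: "c < r" "Suc l < m c"
    using labelling_bound[OF f Suc.prems] by auto
  obtain i0 where i0: "i0 < n" "f i0 = Some (c, l)"
    using labelling_surj[OF f, of c l] b by auto
  obtain c' l' where l': "f' i0 = Some (c', l')" "l \<le> l'"
    using Suc.IH[OF i0] by blast
  obtain j where j: "j < k" "g j = Some (c, Suc l)"
    using labelling_surj[OF g b] by metis
  have "entry (f' i) (g' j) = 1" "entry (f' i0) (g' j) = 0"
    using eq[OF Suc.prems(1) j(1)] eq[OF i0(1) j(1)] Suc.prems i0 j by simp_all
  moreover obtain j0 where j0: "j0 < k" "g j0 = Some (c, l)"
    using labelling_surj[OF g, of c l] b by auto
  have "entry (f' i) (g' j0) = 1" "entry (f' i0) (g' j0) = 1"
    using eq[OF Suc.prems(1) j0(1)] eq[OF i0(1) j0(1)] Suc.prems i0 j0 by simp_all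
  ultimately show ?case
    using l' by (auto simp: entry_eq_Suc_0_iff split: if_splits)
qed

text \<open>Levels are intrinsic to the matrix, and the components are linked by following one row
  of level 0 from each of them. Allowing \<open>r'\<close> to differ from \<open>r\<close> lets the
  same injection serve for the uniqueness of the order and for counting renumberings.\<close>

lemma labelling_unique:
  assumes f: "labelling n r m f" and g: "labelling k r m g"
    and f': "labelling n r' m' f'" and g': "labelling k r' m' g'"
    and pos: "\<And>c. c < r \<Longrightarrow> 0 < m c"
    and eq: "\<And>i j. i < n \<Longrightarrow> j < k \<Longrightarrow> entry (f i) (g j) = entry (f' i) (g' j)"
  obtains \<pi> where "inj_on \<pi> {..<r}" "\<pi> ` {..<r} \<subseteq> {..<r'}"
    "\<And>i. i < n \<Longrightarrow> f' i = relabel \<pi> (f i)" "\<And>j. j < k \<Longrightarrow> g' j = relabel \<pi> (g j)"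
proof -
  have eq': "\<And>i j. i < n \<Longrightarrow> j < k \<Longrightarrow> entry (f' i) (g' j) = entry (f i) (g j)"
    using eq by simp
  \<comment> \<open>\<open>row_le_level\<close> is used in both directions, so the level of a row
    stays fixed and only its component may change.\<close>
  have level: "\<exists>c'. f' i = Some (c', l)" if "i < n" "f i = Some (c, l)" for i c l
    using row_le_level[OF f g f' g' eq that] row_le_level[OF f' g' f g eq' that(1)] that by fastforce
  have "\<exists>i. i < n \<and> f i = Some (c, 0)" if "c < r" for c
    using labelling_surj[OF f that pos[OF that]] by metis
  then obtain rep where rep: "\<And>c. c < r \<Longrightarrow> rep c < n" "\<And>c. c < r \<Longrightarrow> f (rep c) = Some (c, 0)"
    by metis
  define \<pi> where "\<pi> c = fst (the (f' (rep c)))" for c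
  have f'rep: "f' (rep c) = Some (\<pi> c, 0)" if "c < r" for c
    using level[OF rep[OF that]] by (auto simp: \<pi>_def)
  have f'_Some: "f' i = Some (\<pi> c, l)" if i: "i < n" "f i = Some (c, l)" for i c l
  proof -
    have c: "c < r" using labelling_bound[OF f i] by simp
    obtain j where j: "j < k" "g j = Some (c, 0)"
      using labelling_surj[OF g c pos[OF c]] by metis
    \<comment> \<open>A column of level 0 meets every row of its component. In the second labelling
      it therefore ties row \<open>i\<close> to the component of the representative.\<close>
    have "entry (f' i) (g' j) = 1" "entry (f' (rep c)) (g' j) = 1"
      using eq[OF i(1) j(1)] eq[OF rep(1)[OF c] j(1)] i j rep(2)[OF c] by simp_all
    then show ?thesis
      using level[OF i] f'rep[OF c] by (auto simp: entry_eq_Suc_0_iff)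
  qed
  have f'_None: "f' i = None" if i: "i < n" "f i = None" for i
  proof (rule ccontr)
    assume "f' i \<noteq> None"
    then obtain c l where "f' i = Some (c, l)" by fastforce
    from row_le_level[OF f' g' f g eq' i(1) this] i show False by auto
  qed
  have g'_Some: "g' j = Some (\<pi> c, l)" if j: "j < k" "g j = Some (c, l)" for j c l
  proof -
    have c: "c < r" "l < m c" using labelling_bound[OF g j] by simp_all
    obtain i where i: "i < n" "f i = Some (c, l)"
      using labelling_surj[OF f c] by metis
    have "entry (f' i) (g' j) = 1"
      using eq[OF i(1) j(1)] i j by simp
    then obtain l' where l': "g' j = Some (\<pi> c, l')" "l' \<le> l"
      using f'_Some[OF i] by (auto simp: entry_eq_Suc_0_iff)
    \<comment> \<open>If \<open>l'\<close> were smaller than \<open>l\<close>, a row labelled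
      \<open>(c, l')\<close> would miss column \<open>j\<close> in the first labelling and meet it
      in the second.\<close>
    obtain i' where i': "i' < n" "f i' = Some (c, l')"
      using labelling_surj[OF f c(1), of l'] l' c by (metis le_less_trans)
    have "entry (f i') (g j) = 1"
      using eq[OF i'(1) j(1)] f'_Some[OF i'] l' by simp
    then have "l \<le> l'"
      using i' j by (simp split: if_splits)
    with l' show ?thesis by simp
  qed
  have g'_None: "g' j = None" if j: "j < k" "g j = None" for j
  proof (rule ccontr)
    assume "g' j \<noteq> None"
    then obtain c l where cl: "g' j = Some (c, l)" by fastforce
    from labelling_bound[OF g' j(1) this] obtain i where "i < n" "f' i = Some (c, l)"
      using labelling_surj[OF f'] by metis
    then have "entry (f i) (g j) = 1"
      using eq[OF _ j(1)] cl by simp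
    with j(2) show False
      by (simp add: entry_eq_Suc_0_iff)
  qed
  show thesis
  proof
    show "inj_on \<pi> {..<r}"
    proof (rule inj_onI)
      fix c c' assume c: "c \<in> {..<r}" "c' \<in> {..<r}" and "\<pi> c = \<pi> c'"
      then have "f' (rep c) = f' (rep c')"
        using f'rep by simp
      obtain j where j: "j < k" "g j = Some (c, 0)"
        using labelling_surj[OF g _ pos] c by auto
      \<comment> \<open>Column \<open>j\<close> meets \<open>rep c\<close>. Both representatives
        have the same label under \<open>f'\<close>, so it meets \<open>rep c'\<close> as well,
        which forces the components to agree.\<close>
      have "entry (f (rep c')) (g j) = entry (f (rep c)) (g j)"
        using eq[of "rep c" j] eq[of "rep c'" j] rep(1) c j(1) \<open>f' (rep c) = f' (rep c')\<close> by simp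
      then show "c = c'"
        using rep(2) c j by (simp split: if_splits)
    qed
    show "\<pi> ` {..<r} \<subseteq> {..<r'}"
      using labelling_bound(1)[OF f' rep(1) f'rep] by auto
    show "f' i = relabel \<pi> (f i)" if "i < n" for i
      using f'_None[OF that] f'_Some[OF that] by (cases "f i") auto
    show "g' j = relabel \<pi> (g j)" if "j < k" for j
      using g'_None[OF that] g'_Some[OF that] by (cases "g j") auto
  qed
qed

section \<open>Counting labellings\<close>

text \<open>The admissible fibre sizes depend on the value \<open>z\<close>, because the fibre of
  \<open>None\<close> may be empty while the others may not. A value that is not attained counts as
  a fibre of size 0.\<close>

definition funs_fibres :: "'i set \<Rightarrow> 'z set \<Rightarrow> ('z \<Rightarrow> nat set) \<Rightarrow> ('i \<Rightarrow> 'z) set" where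
  "funs_fibres N Z S = {f \<in> N \<rightarrow>\<^sub>E Z. \<forall>z\<in>Z. card {i \<in> N. f i = z} \<in> S z}"

lemma finite_funs_fibres [simp]: "finite N \<Longrightarrow> finite Z \<Longrightarrow> finite (funs_fibres N Z S)"
  by (simp add: funs_fibres_def finite_PiE)

lemma sum_Pow_card:
  fixes h :: "nat \<Rightarrow> 'a :: comm_semiring_1"
  assumes "finite N"
  shows "(\<Sum>B\<in>Pow N. h (card B)) = (\<Sum>b\<le>card N. of_nat (card N choose b) * h b)"
proof -
  have "(\<Sum>B\<in>Pow N. h (card B)) = (\<Sum>b\<le>card N. \<Sum>B\<in>{B \<in> Pow N. card B = b}. h (card B))"
    using assms by (intro sum.group[symmetric]) (auto intro: card_mono)
  also have "\<dots> = (\<Sum>b\<le>card N. of_nat (card N choose b) * h b)"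
    using n_subsets[OF assms] by (intro sum.cong) auto
  finally show ?thesis .
qed

text \<open>A function into \<open>insert z Z\<close> amounts to its fibre \<open>B\<close> over
  \<open>z\<close> together with its restriction to \<open>N - B\<close>, which takes values in
  \<open>Z\<close>.\<close>

lemma card_funs_fibres_insert:
  assumes "finite N" "finite Z" "z \<notin> Z"
  shows "card (funs_fibres N (insert z Z) S) =
    (\<Sum>B\<in>Pow N. if card B \<in> S z then card (funs_fibres (N - B) Z S) else 0)"
proof -
  let ?P = "{B \<in> Pow N. card B \<in> S z}"
  let ?fw = "\<lambda>f. ({i \<in> N. f i = z}, restrict f (N - {i \<in> N. f i = z}))"
  let ?bw = "\<lambda>(B, h). \<lambda>i. if i \<in> B then z else h i"
  have "bij_betw ?fw (funs_fibres N (insert z Z) S) (Sigma ?P (\<lambda>B. funs_fibres (N - B) Z S))"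
  proof (rule bij_betw_byWitness[where f' = ?bw])
    show "\<forall>f\<in>funs_fibres N (insert z Z) S. ?bw (?fw f) = f"
      by (auto simp: funs_fibres_def PiE_def extensional_def fun_eq_iff)
    show "\<forall>p\<in>Sigma ?P (\<lambda>B. funs_fibres (N - B) Z S). ?fw (?bw p) = p"
    proof (rule ballI)
      fix p assume "p \<in> Sigma ?P (\<lambda>B. funs_fibres (N - B) Z S)"
      then obtain B h where p: "p = (B, h)" and B: "B \<subseteq> N" and h: "h \<in> funs_fibres (N - B) Z S"
        by blast
      have hi: "h i \<in> Z" if "i \<in> N - B" for i
        using h that unfolding funs_fibres_def by blast
      then have 1: "{i \<in> N. (if i \<in> B then z else h i) = z} = B"
        using B assms(3) by force
      have "restrict (\<lambda>i. if i \<in> B then z else h i) (N - B) = h"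
        using h by (auto simp: funs_fibres_def PiE_def extensional_def restrict_def fun_eq_iff)
      with 1 show "?fw (?bw p) = p"
        by (simp add: p)
    qed
    show "?fw ` funs_fibres N (insert z Z) S \<subseteq> Sigma ?P (\<lambda>B. funs_fibres (N - B) Z S)"
    proof (rule image_subsetI)
      fix f assume f: "f \<in> funs_fibres N (insert z Z) S"
      let ?B = "{i \<in> N. f i = z}"
      have "{i \<in> N - ?B. restrict f (N - ?B) i = w} = {i \<in> N. f i = w}" if "w \<in> Z" for w
        using that assms(3) by (auto simp: restrict_def)
      moreover have "restrict f (N - ?B) \<in> (N - ?B) \<rightarrow>\<^sub>E Z"
        using f unfolding funs_fibres_def by (auto simp: PiE_iff)
      ultimately have "restrict f (N - ?B) \<in> funs_fibres (N - ?B) Z S"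
        using f unfolding funs_fibres_def by simp
      moreover have "?B \<in> ?P"
        using f unfolding funs_fibres_def by auto
      ultimately show "?fw f \<in> Sigma ?P (\<lambda>B. funs_fibres (N - B) Z S)"
        by blast
    qed
    show "?bw ` Sigma ?P (\<lambda>B. funs_fibres (N - B) Z S) \<subseteq> funs_fibres N (insert z Z) S"
    proof (rule image_subsetI)
      fix p assume "p \<in> Sigma ?P (\<lambda>B. funs_fibres (N - B) Z S)"
      then obtain B h where p: "p = (B, h)" and B: "B \<subseteq> N" "card B \<in> S z"
        and h: "h \<in> funs_fibres (N - B) Z S"
        by blast
      have hi: "h i \<in> Z" if "i \<in> N - B" for i
        using h that unfolding funs_fibres_def by blast
      then have 1: "{i \<in> N. (if i \<in> B then z else h i) = z} = B"
        using B assms(3) by force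
      have 2: "{i \<in> N. (if i \<in> B then z else h i) = w} = {i \<in> N - B. h i = w}" if "w \<in> Z" for w
        using that assms(3) by auto
      have "(\<lambda>i. if i \<in> B then z else h i) \<in> N \<rightarrow>\<^sub>E insert z Z"
        using h B hi by (auto simp: funs_fibres_def PiE_def extensional_def)
      then show "?bw p \<in> funs_fibres N (insert z Z) S"
        using h 1 2 B unfolding funs_fibres_def p by simp
    qed
  qed
  then have "card (funs_fibres N (insert z Z) S) = card (Sigma ?P (\<lambda>B. funs_fibres (N - B) Z S))"
    by (rule bij_betw_same_card)
  also have "\<dots> = (\<Sum>B\<in>?P. card (funs_fibres (N - B) Z S))"
    using assms by (intro card_SigmaI) auto
  also have "\<dots> = (\<Sum>B\<in>Pow N. if card B \<in> S z then card (funs_fibres (N - B) Z S) else 0)"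
    using assms by (intro sum.inter_filter) auto
  finally show ?thesis .
qed

text \<open>The product rule for exponential generating functions: choosing the fibre over one more
  value is a binomial convolution of counts.\<close>

lemma card_funs_fibres:
  assumes "finite Z" "finite N"
  shows "of_nat (card (funs_fibres N Z S)) =
    fact (card N) * fps_nth (\<Prod>z\<in>Z. E (S z)) (card N)"
  using assms
proof (induction Z arbitrary: N rule: finite_induct)
  case empty
  then show ?case
    by (cases "N = {}") (auto simp: funs_fibres_def PiE_eq_empty_iff)
next
  case (insert z Z N)
  define a where "a = (\<Prod>z\<in>Z. E (S z))"
  have "(of_nat (card (funs_fibres N (insert z Z) S)) :: rat) =
      (\<Sum>B\<in>Pow N. if card B \<in> S z then of_nat (card (funs_fibres (N - B) Z S)) else 0)"
    unfolding card_funs_fibres_insert[OF insert.prems insert.hyps] of_nat_sum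
    by (intro sum.cong) auto
  also have "\<dots> = (\<Sum>B\<in>Pow N. if card B \<in> S z
      then fact (card N - card B) * fps_nth a (card N - card B) else 0)"
  proof (intro sum.cong refl)
    fix B assume "B \<in> Pow N"
    then have "finite (N - B)" "card (N - B) = card N - card B"
      using insert.prems by (auto simp: card_Diff_subset finite_subset)
    then show "(if card B \<in> S z then of_nat (card (funs_fibres (N - B) Z S)) else 0) =
      (if card B \<in> S z then fact (card N - card B) * fps_nth a (card N - card B) else (0 :: rat))"
      using insert.IH[of "N - B"] by (simp add: a_def)
  qed
  also have "\<dots> = (\<Sum>b\<le>card N. of_nat (card N choose b) *
      (if b \<in> S z then fact (card N - b) * fps_nth a (card N - b) else 0))"
    by (rule sum_Pow_card[OF insert.prems])
  \<comment> \<open>The factor \<open>fact (card N - b)\<close> cancels against the binomial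
    coefficient, and the remaining \<open>1 / fact b\<close> is the coefficient of
    \<open>E (S z)\<close> for admissible \<open>b\<close>.\<close>
  also have "\<dots> = (\<Sum>b\<le>card N. fact (card N) * (fps_nth (E (S z)) b * fps_nth a (card N - b)))"
    by (intro sum.cong refl) (auto simp: E_def binomial_fact field_simps)
  also have "\<dots> = fact (card N) * fps_nth (\<Prod>z\<in>insert z Z. E (S z)) (card N)"
    using insert.hyps by (simp add: fps_mult_nth a_def sum_distrib_left atLeast0AtMost)
  finally show ?case .
qed

section \<open>Labellings with admissible fibre sizes\<close>

definition labellings :: "nat set \<Rightarrow> nat \<Rightarrow> nat \<Rightarrow> (nat \<Rightarrow> nat) \<Rightarrow> (nat \<Rightarrow> (nat \<times> nat) option) set"
  where "labellings S n r m = {f. labelling n r m f \<and> fibres_in S n f}"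

text \<open>Because \<open>0 \<notin> S\<close>, demanding a fibre size in \<open>S\<close> for each
  \<open>Some\<close> label already forces the label to occur. For \<open>None\<close> the size 0 is
  added, since that label may be missing.\<close>

lemma labellings_eq_funs_fibres:
  assumes "0 \<notin> S"
  shows "labellings S n r m = funs_fibres {..<n} (insert None (Some ` labels r m))
    (\<lambda>z. if z = None then insert 0 S else S)"
proof (intro Set.set_eqI iffI)
  fix f assume "f \<in> labellings S n r m"
  then have f: "labelling n r m f" "fibres_in S n f"
    by (auto simp: labellings_def)
  have *: "card {i \<in> {..<n}. f i = z} \<in> S" if "z \<in> f ` {..<n}" for z
    using f(2) that by (auto simp: fibres_in_def)
  have "card {i \<in> {..<n}. f i = None} \<in> insert 0 S"
  proof (cases "None \<in> f ` {..<n}")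
    case False
    then have "{i \<in> {..<n}. f i = None} = {}"
      by (metis (mono_tags, lifting) Collect_empty_eq image_eqI)
    then show ?thesis by simp
  qed (use * in blast)
  then show "f \<in> funs_fibres {..<n} (insert None (Some ` labels r m))
    (\<lambda>z. if z = None then insert 0 S else S)"
    using f(1) * unfolding funs_fibres_def labelling_def by auto
next
  fix f assume f: "f \<in> funs_fibres {..<n} (insert None (Some ` labels r m))
    (\<lambda>z. if z = None then insert 0 S else S)"
  then have Pi: "f \<in> {..<n} \<rightarrow>\<^sub>E insert None (Some ` labels r m)"
    and Some0: "\<And>z. z \<in> labels r m \<Longrightarrow> card {i \<in> {..<n}. f i = Some z} \<in> S"
    and None0: "card {i \<in> {..<n}. f i = None} \<in> insert 0 S"
    unfolding funs_fibres_def by auto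
  have "Some z \<in> f ` {..<n}" if "z \<in> labels r m" for z
  proof -
    have "{i \<in> {..<n}. f i = Some z} \<noteq> {}"
      using Some0[OF that] assms by (metis card.empty)
    then show ?thesis by force
  qed
  moreover have "card {i'. i' < n \<and> f i' = f i} \<in> S" if "i < n" for i
  proof (cases "f i")
    case None
    have nonzero_in: "q \<in> S" if "q \<noteq> 0" "q \<in> insert 0 S" for q
      using that by simp
    show ?thesis
      unfolding None by (rule nonzero_in) (use that None None0 in auto)
  next
    case (Some z)
    have "f i \<in> insert None (Some ` labels r m)"
      using Pi that by blast
    with Some have "z \<in> labels r m" by auto
    from Some0[OF this] show ?thesis
      by (simp add: Some)
  qed
  ultimately show "f \<in> labellings S n r m"
    using Pi by (auto simp: labellings_def labelling_def fibres_in_def)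
qed

lemma E_insert_0: "0 \<notin> S \<Longrightarrow> E (insert 0 S) = 1 + E S"
  by (rule fps_ext) (auto simp: E_def)

lemma finite_labellings [simp]: "0 \<notin> S \<Longrightarrow> finite (labellings S n r m)"
  by (simp add: labellings_eq_funs_fibres)

lemma card_labels: "card (labels r m) = (\<Sum>c<r. m c)"
  by (simp add: labels_def)

text \<open>Each \<open>Some\<close> label contributes a factor \<open>E S\<close>, and
  \<open>None\<close>, with 0 among its sizes, contributes \<open>1 + E S\<close>.\<close>

lemma card_labellings:
  assumes "0 \<notin> S"
  shows "of_nat (card (labellings S n r m)) =
    fact n * fps_nth ((1 + E S) * E S ^ (\<Sum>c<r. m c)) n"
proof -
  have "(\<Prod>z\<in>insert None (Some ` labels r m). E (if z = None then insert 0 S else S)) =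
      (1 + E S) * (\<Prod>z\<in>labels r m. E S)"
    by (subst prod.insert) (auto simp: prod.reindex E_insert_0[OF assms])
  then show ?thesis
    unfolding labellings_eq_funs_fibres[OF assms]
    by (subst card_funs_fibres) (simp_all add: card_labels)
qed

section \<open>Pairs of row and column labellings with common component sizes\<close>

definition labelling_pairs where
  "labelling_pairs r S1 S2 n k = {(f, g). \<exists>m. (\<forall>c<r. 0 < m c) \<and>
     f \<in> labellings S1 n r m \<and> g \<in> labellings S2 k r m}"

lemma labelling_size_bound:
  assumes "labelling n r m f" "c < r"
  shows "m c \<le> n"
proof -
  have "(\<lambda>l. Some (c, l)) ` {..<m c} \<subseteq> f ` {..<n}"
    using assms unfolding labelling_def by force
  then have "card ((\<lambda>l. Some (c, l)) ` {..<m c}) \<le> card {..<n}"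
    by (meson surj_card_le finite_lessThan)
  then show ?thesis
    by (simp add: card_image inj_on_def)
qed

text \<open>The set of occurring labels can be read off from \<open>f\<close>, and it determines all
  sizes below \<open>r\<close>. This makes the families for different size functions
  disjoint.\<close>

lemma labelling_sizes_unique:
  assumes "labelling n r m f" "labelling n r m' f" "c < r"
  shows "m c = m' c"
proof -
  have "Some ` labels r m = f ` {..<n} - {None}" "Some ` labels r m' = f ` {..<n} - {None}"
    using assms(1,2) unfolding labelling_def by (auto simp: PiE_iff)
  then have "labels r m = labels r m'"
    by (metis inj_image_eq_iff inj_Some)
  then have "l < m c \<longleftrightarrow> l < m' c" for l
    using assms(3) by (metis labels_iff)
  then show ?thesis
    by (meson linorder_neqE_nat order.irrefl)
qed

lemma labelling_restrict: "labelling n r (restrict m {..<r}) = labelling n r m"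
proof -
  have "labels r (restrict m {..<r}) = labels r m"
    by (auto simp: labels_def)
  then show ?thesis
    by (simp add: labelling_def fun_eq_iff)
qed

text \<open>Restricting \<open>m\<close> to \<open>{..<r}\<close> does not change the labellings,
  and \<open>k\<close> columns bound every size by \<open>k\<close>, so the size functions range
  over a finite set. The bound is by \<open>k\<close>, not \<open>n\<close>, to match the later
  truncation in the outer variable \<open>y\<close>.\<close>

lemma labelling_pairs_eq:
  "labelling_pairs r S1 S2 n k =
    (\<Union>m\<in>{..<r} \<rightarrow>\<^sub>E {1..k}. labellings S1 n r m \<times> labellings S2 k r m)"
proof (intro Set.set_eqI iffI; clarify)
  fix f g assume "(f, g) \<in> labelling_pairs r S1 S2 n k"
  then obtain m where m: "\<forall>c<r. 0 < m c" "f \<in> labellings S1 n r m" "g \<in> labellings S2 k r m"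
    by (auto simp: labelling_pairs_def)
  then have "restrict m {..<r} \<in> {..<r} \<rightarrow>\<^sub>E {1..k}"
    using labelling_size_bound[of k r m g] by (auto simp: labellings_def Suc_le_eq)
  moreover have "f \<in> labellings S1 n r (restrict m {..<r})" "g \<in> labellings S2 k r (restrict m {..<r})"
    using m by (simp_all add: labellings_def labelling_restrict)
  ultimately show "(f, g) \<in> (\<Union>m\<in>{..<r} \<rightarrow>\<^sub>E {1..k}. labellings S1 n r m \<times> labellings S2 k r m)"
    by (intro UN_I SigmaI)
next
  fix m f g assume "m \<in> {..<r} \<rightarrow>\<^sub>E {1..k}" "f \<in> labellings S1 n r m" "g \<in> labellings S2 k r m"
  moreover from this(1) have "\<forall>c<r. 0 < m c"
    by (auto dest!: PiE_mem)
  ultimately show "(f, g) \<in> labelling_pairs r S1 S2 n k"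
    unfolding labelling_pairs_def by blast
qed

lemma finite_labelling_pairs:
  "0 \<notin> S1 \<Longrightarrow> 0 \<notin> S2 \<Longrightarrow> finite (labelling_pairs r S1 S2 n k)"
  by (auto simp: labelling_pairs_eq finite_PiE)

lemma card_labelling_pairs:
  assumes "0 \<notin> S1" "0 \<notin> S2"
  shows "card (labelling_pairs r S1 S2 n k) =
    (\<Sum>m\<in>{..<r} \<rightarrow>\<^sub>E {1..k}. card (labellings S1 n r m) * card (labellings S2 k r m))"
  unfolding labelling_pairs_eq
proof (subst card_UN_disjoint)
  show "\<forall>m\<in>{..<r} \<rightarrow>\<^sub>E {1..k}. \<forall>m'\<in>{..<r} \<rightarrow>\<^sub>E {1..k}. m \<noteq> m' \<longrightarrow>
      (labellings S1 n r m \<times> labellings S2 k r m) \<inter> (labellings S1 n r m' \<times> labellings S2 k r m') = {}"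
  proof (intro ballI impI)
    fix m m' assume m: "m \<in> {..<r} \<rightarrow>\<^sub>E {1..k}" "m' \<in> {..<r} \<rightarrow>\<^sub>E {1..k}" and "m \<noteq> m'"
    then obtain c where "c < r" "m c \<noteq> m' c"
      using PiE_ext[OF m] by auto
    then show "(labellings S1 n r m \<times> labellings S2 k r m) \<inter>
        (labellings S1 n r m' \<times> labellings S2 k r m') = {}"
      using labelling_sizes_unique[of n r m _ m' c] by (auto simp: labellings_def)
  qed
qed (use assms in \<open>auto simp: finite_PiE card_cartesian_product\<close>)

section \<open>Generating functions\<close>

lemma in_x_1 [simp]: "in_x 1 = 1"
  and in_x_mult: "in_x (a * b) = in_x a * in_x b"
  and in_x_add: "in_x (a + b) = in_x a + in_x b"
  by (simp_all add: in_x_def)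

lemma in_x_power: "in_x (a ^ m) = in_x a ^ m"
  by (induction m) (simp_all add: in_x_mult)

lemma in_y_1 [simp]: "in_y 1 = 1"
  by (rule fps_ext) (simp add: in_y_def)

lemma in_y_add: "in_y (a + b) = in_y a + in_y b"
  by (rule fps_ext) (simp add: in_y_def)

lemma in_y_mult: "in_y (a * b) = in_y a * in_y b"
proof (rule fps_ext)
  have const_sum: "fps_const (sum h A) = (\<Sum>i\<in>A. fps_const (h i))" for h :: "nat \<Rightarrow> rat" and A
    by (induction A rule: infinite_finite_induct) (simp_all flip: fps_const_add)
  show "fps_nth (in_y (a * b)) k = fps_nth (in_y a * in_y b) k" for k
    by (simp add: in_y_def fps_mult_nth const_sum)
qed

lemma in_y_power: "in_y (a ^ m) = in_y a ^ m"
  by (induction m) (simp_all add: in_y_mult)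

lemma nth_in_x_mult_in_y: "fps_nth (fps_nth (in_x a * in_y b) k) n = fps_nth a n * fps_nth b k"
  by (simp add: in_x_def in_y_def)

section \<open>Truncation of the geometric series\<close>

lemma dvd_power_diff:
  fixes a b :: "'a :: comm_ring_1"
  shows "a - b dvd a ^ r - b ^ r"
  by (simp add: power_diff_sumr2)

lemma fps_nth_power_mult_eq_0:
  fixes T :: "'a :: comm_ring_1 fps"
  assumes "fps_nth T 0 = 0" "k < m"
  shows "fps_nth (T ^ m * F) k = 0"
proof -
  have "fps_nth (T ^ m) i = 0" if "i < m" for i
    using startsby_zero_power_prefix[OF assms(1), of m] that by blast
  with assms(2) show ?thesis
    by (auto simp: fps_mult_nth intro!: sum.neutral)
qed

text \<open>Iteration of \<open>U = 1 + T * U\<close>, with the remainder kept explicit.\<close>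

lemma geometric_truncate:
  fixes T U :: "'a :: comm_ring_1"
  assumes "(1 - T) * U = 1"
  shows "U - 1 = (\<Sum>m\<in>{1..k}. T ^ m) + T ^ Suc k * U"
proof (induction k)
  case 0
  then show ?case using assms by (simp add: algebra_simps)
next
  case (Suc k)
  have "T ^ Suc k * U = T ^ Suc k + T ^ Suc (Suc k) * U"
    using arg_cong[OF assms, of "\<lambda>x. T ^ Suc k * x"] by (simp add: algebra_simps)
  with Suc show ?case by simp
qed

text \<open>Up to a multiple of \<open>T ^ Suc k\<close>, which does not reach coefficient
  \<open>k\<close>, the series \<open>U - 1\<close> is the finite sum \<open>P\<close>; the same
  holds for their \<open>r\<close>-th powers by \<open>dvd_power_diff\<close>. Expanding
  \<open>P ^ r\<close> means choosing an exponent \<open>m c\<close> from each of the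
  \<open>r\<close> factors.\<close>

lemma nth_mult_geometric_power:
  fixes T U F :: "'a :: comm_ring_1 fps"
  assumes T: "fps_nth T 0 = 0" and U: "(1 - T) * U = 1"
  shows "fps_nth (F * (U - 1) ^ r) k =
    fps_nth (\<Sum>m\<in>{..<r} \<rightarrow>\<^sub>E {1..k}. F * T ^ (\<Sum>c<r. m c)) k"
proof -
  define P where "P = (\<Sum>m\<in>{1..k}. T ^ m)"
  have "U - 1 - P = T ^ Suc k * U"
    using geometric_truncate[OF U, of k] by (simp add: P_def)
  then obtain W where W: "(U - 1) ^ r - P ^ r = T ^ Suc k * U * W"
    using dvd_power_diff[of "U - 1" P r] by (metis dvdE)
  have "F * (U - 1) ^ r = F * P ^ r + T ^ Suc k * (U * W * F)"
    using arg_cong[OF W, of "\<lambda>x. F * x"] by (simp add: algebra_simps)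
  then have "fps_nth (F * (U - 1) ^ r) k = fps_nth (F * P ^ r) k"
    using fps_nth_power_mult_eq_0[OF T, of k "Suc k"] by simp
  also have "P ^ r = (\<Prod>c<r. \<Sum>m\<in>{1..k}. T ^ m)"
    by (simp add: P_def)
  also have "\<dots> = (\<Sum>m\<in>{..<r} \<rightarrow>\<^sub>E {1..k}. T ^ (\<Sum>c<r. m c))"
    by (subst prod_sum_PiE) (simp_all add: power_sum)
  finally show ?thesis
    by (simp add: sum_distrib_left)
qed

lemma fps_nth_sum: "fps_nth (sum F A) k = (\<Sum>a\<in>A. fps_nth (F a) k)"
  by (induction A rule: infinite_finite_induct) auto

text \<open>With \<open>0 \<notin> S2\<close> the product \<open>in_x (E S1) * in_y (E S2)\<close>
  has no term free of \<open>y\<close>, so the geometric series may be truncated at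
  \<open>k\<close>. Each summand is a series in \<open>x\<close> times a series in \<open>y\<close>,
  whence its coefficient factorises.\<close>

lemma nth_order_series:
  assumes "0 \<notin> S2"
  shows "fps_nth (fps_nth ((1 + in_x (E S1)) * (1 + in_y (E S2)) *
      (inverse (1 - in_x (E S1) * in_y (E S2)) - 1) ^ r) k) n =
    (\<Sum>m\<in>{..<r} \<rightarrow>\<^sub>E {1..k}. fps_nth ((1 + E S1) * E S1 ^ (\<Sum>c<r. m c)) n *
      fps_nth ((1 + E S2) * E S2 ^ (\<Sum>c<r. m c)) k)"
proof -
  have "(1 + in_x (E S1)) * (1 + in_y (E S2)) * (in_x (E S1) * in_y (E S2)) ^ M =
      in_x ((1 + E S1) * E S1 ^ M) * in_y ((1 + E S2) * E S2 ^ M)" for M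
    by (simp add: in_x_mult in_y_mult in_x_add in_y_add in_x_power in_y_power
        power_mult_distrib mult_ac)
  moreover have "fps_nth (in_x (E S1) * in_y (E S2)) 0 = 0"
    using assms by (simp add: in_y_def E_def)
  ultimately show ?thesis
    by (subst nth_mult_geometric_power[OF _ denominator_mult_inverse[OF assms]])
      (simp_all add: fps_nth_sum nth_in_x_mult_in_y)
qed

lemma card_labelling_pairs_nth:
  assumes "0 \<notin> S1" "0 \<notin> S2"
  shows "of_nat (card (labelling_pairs r S1 S2 n k)) / (fact n * fact k) =
    fps_nth (fps_nth ((1 + in_x (E S1)) * (1 + in_y (E S2)) *
      (inverse (1 - in_x (E S1) * in_y (E S2)) - 1) ^ r) k) n"
  unfolding nth_order_series[OF assms(2)] card_labelling_pairs[OF assms]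
  by (simp add: card_labellings[OF assms(1)] card_labellings[OF assms(2)] sum_divide_distrib)

section \<open>Renumbering the components\<close>

lemma entry_relabel [simp]: "inj \<pi> \<Longrightarrow> entry (relabel \<pi> u) (relabel \<pi> v) = entry u v"
  by (cases "(u, v)" rule: entry.cases) (simp_all add: inj_eq)

lemma labels_permutes:
  assumes "\<pi> permutes {..<r}"
  shows "labels r (m \<circ> inv_into UNIV \<pi>) = map_prod \<pi> id ` labels r m"
proof -
  have "(c, l) \<in> map_prod \<pi> id ` labels r m" if "(c, l) \<in> labels r (m \<circ> inv_into UNIV \<pi>)" for c l
  proof (rule image_eqI[of _ _ "(inv_into UNIV \<pi> c, l)"])
    show "(c, l) = map_prod \<pi> id (inv_into UNIV \<pi> c, l)"
      using permutes_inverses(1)[OF assms] by simp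
    show "(inv_into UNIV \<pi> c, l) \<in> labels r m"
      using that permutes_in_image[OF permutes_inv[OF assms], of c] by simp
  qed
  moreover have "map_prod \<pi> id p \<in> labels r (m \<circ> inv_into UNIV \<pi>)" if "p \<in> labels r m" for p
    using that permutes_in_image[OF assms, of "fst p"] permutes_inverses(2)[OF assms]
    by (cases p) simp
  ultimately show ?thesis
    by auto
qed

text \<open>Component \<open>\<pi> c\<close> of the new labelling is the former component
  \<open>c\<close>, which is why its size is found through the inverse of
  \<open>\<pi>\<close>.\<close>

lemma labelling_permutes:
  assumes \<pi>: "\<pi> permutes {..<r}" and f: "labelling n r m f"
  shows "labelling n r (m \<circ> inv_into UNIV \<pi>) (restrict (relabel \<pi> \<circ> f) {..<n})"
proof -
  have *: "insert None (Some ` labels r (m \<circ> inv_into UNIV \<pi>)) = relabel \<pi> ` insert None (Some ` labels r m)"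
    by (simp add: labels_permutes[OF \<pi>] relabel_def image_image)
  have "restrict (relabel \<pi> \<circ> f) {..<n} \<in> {..<n} \<rightarrow>\<^sub>E insert None (Some ` labels r (m \<circ> inv_into UNIV \<pi>))"
    unfolding *
  proof (rule PiE_I)
    fix i assume i: "i \<in> {..<n}"
    then have "f i \<in> insert None (Some ` labels r m)"
      using f unfolding labelling_def by blast
    with i show "restrict (relabel \<pi> \<circ> f) {..<n} i \<in> relabel \<pi> ` insert None (Some ` labels r m)"
      by (simp only: restrict_apply' comp_apply imageI)
  qed simp
  moreover have "Some ` labels r (m \<circ> inv_into UNIV \<pi>) = relabel \<pi> ` Some ` labels r m"
    by (simp add: labels_permutes[OF \<pi>] relabel_def image_image)
  then have "Some ` labels r (m \<circ> inv_into UNIV \<pi>) \<subseteq> relabel \<pi> ` f ` {..<n}"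
    using f unfolding labelling_def by (simp add: image_mono)
  ultimately show ?thesis
    unfolding labelling_def by (simp add: image_image)
qed

lemma stair_mat_permutes:
  assumes "inj \<pi>"
  shows "stair_mat n k (restrict (relabel \<pi> \<circ> f) {..<n}) (restrict (relabel \<pi> \<circ> g) {..<k}) =
    stair_mat n k f g"
  by (rule eq_matI) (simp_all add: assms)

definition stair_mats where
  "stair_mats r S1 S2 n k = (\<lambda>(f, g). stair_mat n k f g) ` labelling_pairs r S1 S2 n k"

text \<open>The multiplicity conditions are moved from the labellings to the matrix, so that they
  pass between pairs with the same matrix.\<close>

lemma labelling_pairs_iff:
  "(f, g) \<in> labelling_pairs r S1 S2 n k \<longleftrightarrow> (\<exists>m. (\<forall>c<r. 0 < m c) \<and>
     labelling n r m f \<and> labelling k r m g \<and>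
     row_multiplicities_in S1 (stair_mat n k f g) \<and> col_multiplicities_in S2 (stair_mat n k f g))"
  unfolding labelling_pairs_def labellings_def
  using row_multiplicities_stair_mat col_multiplicities_stair_mat by auto

text \<open>The permutations of \<open>{..<r}\<close> act on the pairs by renumbering components.
  The action is free because every component has a row of level 0, and
  \<open>labelling_unique\<close> makes it transitive on the pairs with a given matrix.\<close>

lemma card_stair_mat_fibre:
  assumes "(f, g) \<in> labelling_pairs r S1 S2 n k"
  shows "card {(f', g') \<in> labelling_pairs r S1 S2 n k. stair_mat n k f' g' = stair_mat n k f g} = fact r"
proof -
  define act where "act \<pi> = (restrict (relabel \<pi> \<circ> f) {..<n}, restrict (relabel \<pi> \<circ> g) {..<k})" for \<pi>
  obtain m where m: "\<forall>c<r. 0 < m c" and f: "labelling n r m f" and g: "labelling k r m g"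
    and mult: "row_multiplicities_in S1 (stair_mat n k f g)" "col_multiplicities_in S2 (stair_mat n k f g)"
    using assms labelling_pairs_iff by auto
  have "bij_betw act {\<pi>. \<pi> permutes {..<r}}
      {(f', g') \<in> labelling_pairs r S1 S2 n k. stair_mat n k f' g' = stair_mat n k f g}"
  proof (rule bij_betw_imageI)
    show "inj_on act {\<pi>. \<pi> permutes {..<r}}"
    proof (rule inj_onI, clarify, rule ext)
      fix \<pi> \<pi>' c assume \<pi>: "\<pi> permutes {..<r}" "\<pi>' permutes {..<r}" and "act \<pi> = act \<pi>'"
      then have "restrict (relabel \<pi> \<circ> f) {..<n} = restrict (relabel \<pi>' \<circ> f) {..<n}"
        by (simp only: act_def prod.inject)
      then have eq: "relabel \<pi> (f i) = relabel \<pi>' (f i)" if "i < n" for i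
        using that by (metis comp_apply lessThan_iff restrict_apply')
      show "\<pi> c = \<pi>' c"
      proof (cases "c < r")
        case True
        then obtain i where "i < n" "f i = Some (c, 0)"
          using labelling_surj[OF f True m[rule_format, OF True]] by metis
        then show ?thesis using eq[of i] by simp
      next
        case False
        then show ?thesis using \<pi> by (simp add: permutes_def)
      qed
    qed
    show "act ` {\<pi>. \<pi> permutes {..<r}} =
      {(f', g') \<in> labelling_pairs r S1 S2 n k. stair_mat n k f' g' = stair_mat n k f g}"
    proof (intro subset_antisym subsetI)
      fix p assume "p \<in> act ` {\<pi>. \<pi> permutes {..<r}}"
      then obtain \<pi> where \<pi>: "\<pi> permutes {..<r}" and p: "p = act \<pi>" by blast
      have "\<forall>c<r. 0 < (m \<circ> inv_into UNIV \<pi>) c"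
        using m permutes_in_image[OF permutes_inv[OF \<pi>]] by simp
      then have "act \<pi> \<in> labelling_pairs r S1 S2 n k"
        using labelling_permutes[OF \<pi> f] labelling_permutes[OF \<pi> g] mult
        unfolding act_def labelling_pairs_iff stair_mat_permutes[OF permutes_inj[OF \<pi>]] by blast
      then show "p \<in> {(f', g') \<in> labelling_pairs r S1 S2 n k. stair_mat n k f' g' = stair_mat n k f g}"
        using stair_mat_permutes[OF permutes_inj[OF \<pi>]] by (simp add: p act_def)
    next
      fix p assume "p \<in> {(f', g') \<in> labelling_pairs r S1 S2 n k. stair_mat n k f' g' = stair_mat n k f g}"
      then obtain f' g' where p: "p = (f', g')" "(f', g') \<in> labelling_pairs r S1 S2 n k"
        and eq: "stair_mat n k f' g' = stair_mat n k f g"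
        by blast
      then obtain m' where f': "labelling n r m' f'" and g': "labelling k r m' g'"
        using labelling_pairs_iff by blast
      have "entry (f i) (g j) = entry (f' i) (g' j)" if "i < n" "j < k" for i j
        using arg_cong[OF eq, of "\<lambda>A. A $$ (i, j)"] that by simp
      then obtain \<pi> where \<pi>: "inj_on \<pi> {..<r}" "\<pi> ` {..<r} \<subseteq> {..<r}"
        "\<And>i. i < n \<Longrightarrow> f' i = relabel \<pi> (f i)" "\<And>j. j < k \<Longrightarrow> g' j = relabel \<pi> (g j)"
        using labelling_unique[OF f g f' g'] m by metis
      \<comment> \<open>\<open>\<pi>\<close> is controlled only below \<open>r\<close>; continuing
        it by the identity gives a permutation in the sense of \<open>permutes\<close>.\<close>
      define \<sigma> where "\<sigma> c = (if c < r then \<pi> c else c)" for c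
      have "bij_betw \<pi> {..<r} {..<r}"
        using \<pi>(1,2) by (simp add: bij_betw_def endo_inj_surj)
      then have "\<sigma> permutes {..<r}"
        using bij_betw_cong[of "{..<r}" \<sigma> \<pi>] by (intro bij_imp_permutes) (auto simp: \<sigma>_def)
      moreover have "relabel \<sigma> (f i) = relabel \<pi> (f i)" if "i < n" for i
        using labelling_bound(1)[OF f that] by (cases "f i") (auto simp: \<sigma>_def)
      moreover have "relabel \<sigma> (g j) = relabel \<pi> (g j)" if "j < k" for j
        using labelling_bound(1)[OF g that] by (cases "g j") (auto simp: \<sigma>_def)
      ultimately have "f' = restrict (relabel \<sigma> \<circ> f) {..<n}" "g' = restrict (relabel \<sigma> \<circ> g) {..<k}"
        using \<pi>(3,4) labelling_ext[OF f' labelling_permutes[OF _ f]]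
          labelling_ext[OF g' labelling_permutes[OF _ g]] by auto
      with \<open>\<sigma> permutes {..<r}\<close> show "p \<in> act ` {\<pi>. \<pi> permutes {..<r}}"
        by (auto simp: p act_def)
    qed
  qed
  then show ?thesis
    using card_permutations[of "{..<r}" r] bij_betw_same_card by fastforce
qed

lemma card_labelling_pairs_stair_mats:
  assumes "0 \<notin> S1" "0 \<notin> S2"
  shows "card (labelling_pairs r S1 S2 n k) = fact r * card (stair_mats r S1 S2 n k)"
proof -
  let ?X = "labelling_pairs r S1 S2 n k" and ?h = "\<lambda>(f, g). stair_mat n k f g"
  have "card ?X = (\<Sum>A\<in>stair_mats r S1 S2 n k. card {p \<in> ?X. ?h p = A})"
    using sum.group[OF finite_labelling_pairs[OF assms],
        where T = "stair_mats r S1 S2 n k" and g = ?h and h = "\<lambda>_. 1 :: nat"]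
      finite_labelling_pairs[OF assms]
    by (simp add: stair_mats_def)
  also have "\<dots> = (\<Sum>A\<in>stair_mats r S1 S2 n k. fact r)"
  proof (intro sum.cong refl)
    fix A assume "A \<in> stair_mats r S1 S2 n k"
    then obtain f g where fg: "(f, g) \<in> ?X" "A = stair_mat n k f g"
      by (auto simp: stair_mats_def)
    have "{p \<in> ?X. ?h p = A} = {(f', g') \<in> ?X. stair_mat n k f' g' = stair_mat n k f g}"
      by (auto simp: fg(2))
    then show "card {p \<in> ?X. ?h p = A} = fact r"
      using card_stair_mat_fibre[OF fg(1)] by simp
  qed
  finally show ?thesis by simp
qed

section \<open>Lonesum matrices\<close>

text \<open>Serves to show that a switch on two rows and two columns preserves the row and column
  sums.\<close>

lemma sum_exchange_two:
  fixes h h' :: "'i \<Rightarrow> 'a :: comm_monoid_add"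
  assumes "finite I" "j \<in> I" "j' \<in> I" "j \<noteq> j'" "h j + h j' = h' j + h' j'"
    and "\<And>x. x \<in> I \<Longrightarrow> x \<noteq> j \<Longrightarrow> x \<noteq> j' \<Longrightarrow> h x = h' x"
  shows "sum h I = sum h' I"
proof -
  have split: "sum u I = (u j + u j') + sum u (I - {j} - {j'})" for u :: "'i \<Rightarrow> 'a"
    using assms(1-4) by (simp add: sum.remove[of I j] sum.remove[of "I - {j}" j'] add.assoc)
  have "sum h (I - {j} - {j'}) = sum h' (I - {j} - {j'})"
    using assms(6) by (intro sum.cong) auto
  then show ?thesis
    unfolding split[of h] split[of h'] assms(5) by simp
qed

text \<open>Two incomparable rows contain a 2 by 2 identity pattern, up to order. Switching its
  zeros and ones gives a different matrix with the same sums.\<close>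

lemma lonesum_rows_nested:
  assumes L: "lonesum_mat L" and i: "i < dim_row L" "i' < dim_row L"
  shows "(\<forall>j<dim_col L. L $$ (i, j) \<noteq> 0 \<longrightarrow> L $$ (i', j) \<noteq> 0) \<or>
    (\<forall>j<dim_col L. L $$ (i', j) \<noteq> 0 \<longrightarrow> L $$ (i, j) \<noteq> 0)"
proof (rule ccontr)
  assume "\<not> ?thesis"
  then obtain j j' where j: "j < dim_col L" "L $$ (i, j) \<noteq> 0" "L $$ (i', j) = 0"
    and j': "j' < dim_col L" "L $$ (i', j') \<noteq> 0" "L $$ (i, j') = 0" by blast
  have 01: "L $$ (a, b) = 0 \<or> L $$ (a, b) = 1" if "a < dim_row L" "b < dim_col L" for a b
    using L that unfolding lonesum_mat_def zero_one_mat_iff by blast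
  have one: "L $$ (i, j) = 1" "L $$ (i', j') = 1"
    using 01[OF i(1) j(1)] 01[OF i(2) j'(1)] j(2) j'(2) by simp_all
  have ne: "i \<noteq> i'" "j \<noteq> j'" using j j' by auto
  \<comment> \<open>The switch: the four entries in rows \<open>i\<close>, \<open>i'\<close> and
    columns \<open>j\<close>, \<open>j'\<close> are complemented.\<close>
  define B where "B = mat (dim_row L) (dim_col L) (\<lambda>(a, b).
    if (a = i \<or> a = i') \<and> (b = j \<or> b = j') then 1 - L $$ (a, b) else L $$ (a, b))"
  have B: "B \<in> carrier_mat (dim_row L) (dim_col L)"
    by (simp add: B_def)
  have idx: "B $$ (a, b) = (if (a = i \<or> a = i') \<and> (b = j \<or> b = j') then 1 - L $$ (a, b) else L $$ (a, b))"
    if "a < dim_row L" "b < dim_col L" for a b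
    using that by (simp add: B_def)
  have "zero_one_mat B"
    unfolding zero_one_mat_iff
  proof (intro allI impI)
    fix a b assume ab: "a < dim_row B" "b < dim_col B"
    then have ab': "a < dim_row L" "b < dim_col L" by (simp_all add: B_def)
    show "B $$ (a, b) = 0 \<or> B $$ (a, b) = 1"
      using idx[OF ab'] 01[OF ab'] by (auto split: if_splits)
  qed
  moreover have "row_sum_vec B = row_sum_vec L"
  proof (rule eq_vecI)
    fix a assume "a < dim_vec (row_sum_vec L)"
    then have a: "a < dim_row L" by (simp add: row_sum_vec_def)
    have "(\<Sum>b<dim_col L. B $$ (a, b)) = (\<Sum>b<dim_col L. L $$ (a, b))"
      by (rule sum_exchange_two[where j = j and j' = j'])
        (use a j j' one ne in \<open>auto simp: idx\<close>)
    then show "row_sum_vec B $ a = row_sum_vec L $ a"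
      using a by (simp add: row_sum_vec_def B_def)
  qed (simp add: row_sum_vec_def B_def)
  moreover have "col_sum_vec B = col_sum_vec L"
  proof (rule eq_vecI)
    fix b assume "b < dim_vec (col_sum_vec L)"
    then have b: "b < dim_col L" by (simp add: col_sum_vec_def)
    have "(\<Sum>a<dim_row L. B $$ (a, b)) = (\<Sum>a<dim_row L. L $$ (a, b))"
      by (rule sum_exchange_two[where j = i and j' = i'])
        (use b i j j' one ne in \<open>auto simp: idx\<close>)
    then show "col_sum_vec B $ b = col_sum_vec L $ b"
      using b by (simp add: col_sum_vec_def B_def)
  qed (simp add: col_sum_vec_def B_def)
  ultimately have "B = L"
    using L B unfolding lonesum_mat_def by blast
  then show False
    using idx[of i j] i j one by simp
qed

text \<open>The sum of the entries weighted by \<open>2 * (a i - b j) + 1\<close> depends only on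
  the row and column sums, and \<open>L\<close> is its only maximiser among the 0/1 matrices of its
  size, having ones exactly where the weight is positive.\<close>

lemma lonesum_threshold:
  fixes a b :: "nat \<Rightarrow> int"
  assumes L: "zero_one_mat L"
    and thr: "\<And>i j. i < dim_row L \<Longrightarrow> j < dim_col L \<Longrightarrow> L $$ (i, j) = 1 \<longleftrightarrow> b j \<le> a i"
  shows "lonesum_mat L"
  unfolding lonesum_mat_def
proof (intro conjI ballI impI L)
  fix B assume B: "B \<in> carrier_mat (dim_row L) (dim_col L)"
    and "zero_one_mat B \<and> row_sum_vec B = row_sum_vec L \<and> col_sum_vec B = col_sum_vec L"
  then have 01: "zero_one_mat B" and row: "row_sum_vec B = row_sum_vec L"
    and col: "col_sum_vec B = col_sum_vec L" by simp_all
  have dim: "dim_row B = dim_row L" "dim_col B = dim_col L"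
    using B by auto
  let ?I = "{..<dim_row L}" and ?J = "{..<dim_col L}"
  \<comment> \<open>Equal row and column sums make \<open>d\<close> orthogonal to \<open>w\<close>; the summand 1 keeps \<open>w\<close> away from 0,
    positive where \<open>L\<close> is 1 and negative where \<open>L\<close> is 0, so that \<open>d i j * w i j \<le> 0\<close> throughout.\<close>
  define d where "d i j = int (B $$ (i, j)) - int (L $$ (i, j))" for i j
  define w where "w i j = 2 * (a i - b j) + 1" for i j
  have d_row: "(\<Sum>j\<in>?J. d i j) = 0" if "i \<in> ?I" for i
    using arg_cong[OF row, of "\<lambda>v. v $ i"] that
    by (simp add: row_sum_vec_def dim d_def sum_subtractf flip: of_nat_sum)
  have d_col: "(\<Sum>i\<in>?I. d i j) = 0" if "j \<in> ?J" for j
    using arg_cong[OF col, of "\<lambda>v. v $ j"] that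
    by (simp add: col_sum_vec_def dim d_def sum_subtractf flip: of_nat_sum)
  have le: "d i j * w i j \<le> 0" and eq: "d i j * w i j = 0 \<Longrightarrow> B $$ (i, j) = L $$ (i, j)"
    if ij: "i \<in> ?I" "j \<in> ?J" for i j
  proof -
    have vals: "B $$ (i, j) = 0 \<or> B $$ (i, j) = 1" "L $$ (i, j) = 0 \<or> L $$ (i, j) = 1"
      using 01 L ij by (auto simp: zero_one_mat_iff dim)
    have w: "if L $$ (i, j) = 1 then w i j > 0 else w i j < 0"
      using thr[of i j] ij by (simp add: w_def)
    show "d i j * w i j \<le> 0"
      using vals w by (auto simp: d_def)
    show "B $$ (i, j) = L $$ (i, j)" if "d i j * w i j = 0"
      using that w by (auto simp: d_def split: if_splits)
  qed
  have "(\<Sum>i\<in>?I. \<Sum>j\<in>?J. d i j * w i j) =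
      (\<Sum>i\<in>?I. \<Sum>j\<in>?J. (2 * a i + 1) * d i j) - (\<Sum>i\<in>?I. \<Sum>j\<in>?J. 2 * b j * d i j)"
    by (simp add: w_def algebra_simps sum.distrib sum_subtractf)
  also have "(\<Sum>i\<in>?I. \<Sum>j\<in>?J. (2 * a i + 1) * d i j) = 0"
    using d_row by (simp flip: sum_distrib_left)
  also have "(\<Sum>i\<in>?I. \<Sum>j\<in>?J. 2 * b j * d i j) = (\<Sum>j\<in>?J. \<Sum>i\<in>?I. 2 * b j * d i j)"
    by (rule sum.swap)
  also have "\<dots> = 0"
    using d_col by (simp flip: sum_distrib_left)
  finally have total: "(\<Sum>i\<in>?I. \<Sum>j\<in>?J. - (d i j * w i j)) = 0"
    by (simp add: sum_negf)
  have row0: "\<forall>i\<in>?I. (\<Sum>j\<in>?J. - (d i j * w i j)) = 0"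
    by (rule iffD1[OF sum_nonneg_eq_0_iff total]) (simp, rule sum_nonneg, use le in simp)
  have "d i j * w i j = 0" if "i \<in> ?I" "j \<in> ?J" for i j
  proof -
    have "\<forall>j\<in>?J. - (d i j * w i j) = 0"
      by (rule iffD1[OF sum_nonneg_eq_0_iff bspec[OF row0 that(1)]]) (use le that in auto)
    then show ?thesis using that by simp
  qed
  then show "B = L"
    using eq dim by (intro eq_matI) auto
qed

section \<open>Block diagonal matrices\<close>

text \<open>Indexing by lists makes a reordering of rows and columns a reordering of lists, and
  block decomposition a matter of concatenation.\<close>

definition list_mat :: "('x \<Rightarrow> 'y \<Rightarrow> 'a) \<Rightarrow> 'x list \<Rightarrow> 'y list \<Rightarrow> 'a mat" where
  "list_mat a xs ys = mat (length xs) (length ys) (\<lambda>(i, j). a (xs ! i) (ys ! j))"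

lemma dim_list_mat [simp]:
  "dim_row (list_mat a xs ys) = length xs" "dim_col (list_mat a xs ys) = length ys"
  by (simp_all add: list_mat_def)

lemma index_list_mat [simp]:
  "i < length xs \<Longrightarrow> j < length ys \<Longrightarrow> list_mat a xs ys $$ (i, j) = a (xs ! i) (ys ! j)"
  by (simp add: list_mat_def)

lemma list_mat_append:
  fixes a :: "'x \<Rightarrow> 'y \<Rightarrow> 'a :: zero"
  assumes "\<And>x y. x \<in> set xs \<Longrightarrow> y \<in> set ys' \<Longrightarrow> a x y = 0"
    and "\<And>x y. x \<in> set xs' \<Longrightarrow> y \<in> set ys \<Longrightarrow> a x y = 0"
  shows "list_mat a (xs @ xs') (ys @ ys') = four_block_mat (list_mat a xs ys)
    (0\<^sub>m (length xs) (length ys')) (0\<^sub>m (length xs') (length ys)) (list_mat a xs' ys')"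
proof (rule eq_matI, goal_cases)
  case (1 i j)
  then show ?case
    using assms by (auto simp: nth_append)
qed simp_all

text \<open>Once the indices are grouped by component, nonzero entries occur only inside a group.
  Distinctness of \<open>cs\<close> ensures that the first group shares no component with the later
  ones.\<close>

lemma diag_block_list_mat:
  fixes a :: "'x \<Rightarrow> 'y \<Rightarrow> 'a :: zero"
  assumes "distinct cs" and "\<And>x y. a x y \<noteq> 0 \<Longrightarrow> x \<in> set xs \<Longrightarrow> y \<in> set ys \<Longrightarrow> \<beta> x = \<gamma> y"
  shows "diag_block_mat (map (\<lambda>c. list_mat a (filter (\<lambda>x. \<beta> x = c) xs) (filter (\<lambda>y. \<gamma> y = c) ys)) cs) =
    list_mat a (concat (map (\<lambda>c. filter (\<lambda>x. \<beta> x = c) xs) cs))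
      (concat (map (\<lambda>c. filter (\<lambda>y. \<gamma> y = c) ys) cs))"
  using assms(1)
proof (induction cs)
  case Nil
  show ?case by (rule eq_matI) simp_all
next
  case (Cons c cs)
  have "list_mat a (concat (map (\<lambda>c. filter (\<lambda>x. \<beta> x = c) xs) (c # cs)))
      (concat (map (\<lambda>c. filter (\<lambda>y. \<gamma> y = c) ys) (c # cs))) =
    four_block_mat (list_mat a (filter (\<lambda>x. \<beta> x = c) xs) (filter (\<lambda>y. \<gamma> y = c) ys))
      (0\<^sub>m (length (filter (\<lambda>x. \<beta> x = c) xs)) (length (concat (map (\<lambda>c. filter (\<lambda>y. \<gamma> y = c) ys) cs))))
      (0\<^sub>m (length (concat (map (\<lambda>c. filter (\<lambda>x. \<beta> x = c) xs) cs))) (length (filter (\<lambda>y. \<gamma> y = c) ys)))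
      (list_mat a (concat (map (\<lambda>c. filter (\<lambda>x. \<beta> x = c) xs) cs))
        (concat (map (\<lambda>c. filter (\<lambda>y. \<gamma> y = c) ys) cs)))"
    unfolding list.map concat.simps using Cons.prems assms(2) by (intro list_mat_append) force+
  with Cons show ?case
    by (simp add: Let_def)
qed

text \<open>A description of block diagonal form that is insensitive to permutations:
  \<open>\<beta>\<close> and \<open>\<gamma>\<close> give the blocks of rows and columns, zero ones
  included. The last clause makes all \<open>s\<close> blocks non-zero.\<close>

definition nested_blocks :: "nat \<Rightarrow> nat mat \<Rightarrow> (nat \<Rightarrow> nat) \<Rightarrow> (nat \<Rightarrow> nat) \<Rightarrow> bool" where
  "nested_blocks s A \<beta> \<gamma> \<longleftrightarrow>
     (\<forall>i<dim_row A. \<beta> i < s) \<and> (\<forall>j<dim_col A. \<gamma> j < s) \<and>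
     (\<forall>i<dim_row A. \<forall>j<dim_col A. A $$ (i, j) \<noteq> 0 \<longrightarrow> \<beta> i = \<gamma> j) \<and>
     (\<forall>i<dim_row A. \<forall>i'<dim_row A. \<beta> i = \<beta> i' \<longrightarrow>
        (\<forall>j<dim_col A. A $$ (i, j) \<noteq> 0 \<longrightarrow> A $$ (i', j) \<noteq> 0) \<or>
        (\<forall>j<dim_col A. A $$ (i', j) \<noteq> 0 \<longrightarrow> A $$ (i, j) \<noteq> 0)) \<and>
     (\<forall>c<s. \<exists>i<dim_row A. \<exists>j<dim_col A. A $$ (i, j) \<noteq> 0 \<and> \<beta> i = c)"

text \<open>Induction on the list of blocks: the first block becomes number 0 and the others move up
  by one. Nestedness inside a block is \<open>lonesum_rows_nested\<close>.\<close>

lemma nested_blocks_diag_block_mat: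
  assumes "\<And>L. L \<in> set Ls \<Longrightarrow> lonesum_mat L \<and> \<not> all_zero_mat L"
  shows "\<exists>\<beta> \<gamma>. nested_blocks (length Ls) (diag_block_mat Ls) \<beta> \<gamma>"
  using assms
proof (induction Ls)
  case Nil
  show ?case by (simp add: nested_blocks_def)
next
  case (Cons L Ls)
  let ?D = "diag_block_mat Ls"
  define D' where "D' = diag_block_mat (L # Ls)"
  obtain \<beta> \<gamma> where "nested_blocks (length Ls) ?D \<beta> \<gamma>"
    using Cons.IH Cons.prems by (meson list.set_intros(2))
  then have
    \<beta>: "\<And>i. i < dim_row ?D \<Longrightarrow> \<beta> i < length Ls" and
    \<gamma>: "\<And>j. j < dim_col ?D \<Longrightarrow> \<gamma> j < length Ls" and
    eq: "\<And>i j. i < dim_row ?D \<Longrightarrow> j < dim_col ?D \<Longrightarrow> ?D $$ (i, j) \<noteq> 0 \<Longrightarrow> \<beta> i = \<gamma> j" and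
    nested: "\<And>i i'. i < dim_row ?D \<Longrightarrow> i' < dim_row ?D \<Longrightarrow> \<beta> i = \<beta> i' \<Longrightarrow>
       (\<forall>j<dim_col ?D. ?D $$ (i, j) \<noteq> 0 \<longrightarrow> ?D $$ (i', j) \<noteq> 0) \<or>
       (\<forall>j<dim_col ?D. ?D $$ (i', j) \<noteq> 0 \<longrightarrow> ?D $$ (i, j) \<noteq> 0)" and
    ex: "\<And>c. c < length Ls \<Longrightarrow> \<exists>i<dim_row ?D. \<exists>j<dim_col ?D. ?D $$ (i, j) \<noteq> 0 \<and> \<beta> i = c"
    unfolding nested_blocks_def by simp_all
  have L: "lonesum_mat L" "\<not> all_zero_mat L"
    using Cons.prems by simp_all
  have dim: "dim_row D' = dim_row L + dim_row ?D" "dim_col D' = dim_col L + dim_col ?D"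
    by (simp_all add: D'_def Let_def)
  have idx: "D' $$ (i, j) = (if i < dim_row L then if j < dim_col L then L $$ (i, j) else 0
      else if j < dim_col L then 0 else ?D $$ (i - dim_row L, j - dim_col L))"
    if "i < dim_row D'" "j < dim_col D'" for i j
    using that by (auto simp: D'_def Let_def)
  let ?\<beta> = "\<lambda>i. if i < dim_row L then 0 else Suc (\<beta> (i - dim_row L))"
  let ?\<gamma> = "\<lambda>j. if j < dim_col L then 0 else Suc (\<gamma> (j - dim_col L))"
  have "nested_blocks (length (L # Ls)) D' ?\<beta> ?\<gamma>"
    unfolding nested_blocks_def
  proof (intro conjI allI impI)
    show "?\<beta> i < length (L # Ls)" if "i < dim_row D'" for i
      using that \<beta>[of "i - dim_row L"] by (simp add: dim)
    show "?\<gamma> j < length (L # Ls)" if "j < dim_col D'" for j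
      using that \<gamma>[of "j - dim_col L"] by (simp add: dim)
    show "?\<beta> i = ?\<gamma> j" if "i < dim_row D'" "j < dim_col D'" "D' $$ (i, j) \<noteq> 0" for i j
      using that(3) eq[of "i - dim_row L" "j - dim_col L"] that(1,2)
      unfolding idx[OF that(1,2)] by (auto simp: dim split: if_splits)
    show "(\<forall>j<dim_col D'. D' $$ (i, j) \<noteq> 0 \<longrightarrow> D' $$ (i', j) \<noteq> 0) \<or>
       (\<forall>j<dim_col D'. D' $$ (i', j) \<noteq> 0 \<longrightarrow> D' $$ (i, j) \<noteq> 0)"
      if i: "i < dim_row D'" "i' < dim_row D'" and "?\<beta> i = ?\<beta> i'" for i i'
    proof (cases "i < dim_row L")
      case True
      then have "i' < dim_row L" using that(3) by (simp split: if_splits)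
      with lonesum_rows_nested[OF L(1) True this] True show ?thesis
        using i by (auto simp: idx split: if_splits)
    next
      case False
      then have i': "\<not> i' < dim_row L" "\<beta> (i - dim_row L) = \<beta> (i' - dim_row L)"
        using that(3) by (auto split: if_splits)
      have "(\<forall>j<dim_col ?D. ?D $$ (i - dim_row L, j) \<noteq> 0 \<longrightarrow> ?D $$ (i' - dim_row L, j) \<noteq> 0) \<or>
       (\<forall>j<dim_col ?D. ?D $$ (i' - dim_row L, j) \<noteq> 0 \<longrightarrow> ?D $$ (i - dim_row L, j) \<noteq> 0)"
        using False i' i by (intro nested) (auto simp: dim)
      moreover have "j - dim_col L < dim_col ?D" if "j < dim_col D'" "\<not> j < dim_col L" for j
        using that by (simp add: dim)
      ultimately show ?thesis
        using False i' i by (simp add: idx) blast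
    qed
    show "\<exists>i<dim_row D'. \<exists>j<dim_col D'. D' $$ (i, j) \<noteq> 0 \<and> ?\<beta> i = c" if "c < length (L # Ls)" for c
    proof (cases c)
      case 0
      obtain i j where ij: "i < dim_row L" "j < dim_col L" "L $$ (i, j) \<noteq> 0"
        using L(2) unfolding all_zero_mat_def by (metis eq_matI index_zero_mat)
      show ?thesis
        using ij 0 by (intro exI[of _ i] exI[of _ j] conjI) (simp_all add: dim idx)
    next
      case (Suc c')
      then have "c' < length Ls" using that by simp
      from ex[OF this] obtain i j
        where "i < dim_row ?D" "j < dim_col ?D" "?D $$ (i, j) \<noteq> 0" "\<beta> i = c'"
        by blast
      then show ?thesis
        using Suc by (intro exI[of _ "dim_row L + i"] exI[of _ "dim_col L + j"] conjI)
          (simp_all add: dim idx)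
    qed
  qed
  then show ?case
    unfolding D'_def by blast
qed

section \<open>Labellings from nested blocks\<close>

text \<open>Along a chain the number of proper predecessors increases strictly, so it is injective
  into a set of the same size. It numbers the row types of a component from 0.\<close>

lemma finite_chain_rank:
  fixes C :: "'a set set"
  assumes "finite C" and chain: "\<And>X Y. X \<in> C \<Longrightarrow> Y \<in> C \<Longrightarrow> X \<subseteq> Y \<or> Y \<subseteq> X"
  shows "bij_betw (\<lambda>X. card {Y \<in> C. Y \<subset> X}) C {..<card C}"
proof -
  let ?\<rho> = "\<lambda>X. card {Y \<in> C. Y \<subset> X}"
  have mono: "?\<rho> X < ?\<rho> Y" if "X \<in> C" "X \<subset> Y" for X Y
  proof (rule psubset_card_mono)
    show "finite {Z \<in> C. Z \<subset> Y}" using assms(1) by simp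
    show "{Z \<in> C. Z \<subset> X} \<subset> {Z \<in> C. Z \<subset> Y}" using that by blast
  qed
  have inj: "inj_on ?\<rho> C"
  proof (rule inj_onI, rule ccontr)
    fix X Y assume X: "X \<in> C" and Y: "Y \<in> C" and eq: "?\<rho> X = ?\<rho> Y" and "X \<noteq> Y"
    then consider "X \<subset> Y" | "Y \<subset> X"
      using chain[OF X Y] by blast
    then show False
      using mono[OF X, of Y] mono[OF Y, of X] unfolding eq by cases blast+
  qed
  have "?\<rho> X < card C" if "X \<in> C" for X
    using that assms(1) by (intro psubset_card_mono) auto
  then have "?\<rho> ` C \<subseteq> {..<card C}" by blast
  moreover have "card (?\<rho> ` C) = card {..<card C}"
    using inj by (simp add: card_image)
  ultimately have "?\<rho> ` C = {..<card C}"
    by (intro card_subset_eq) simp_all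
  with inj show ?thesis by (simp add: bij_betw_def)
qed

text \<open>Any element of \<open>X\<close> outside its largest proper predecessor will do. It
  supplies a column whose level equals the rank of the row type \<open>X\<close>.\<close>

lemma finite_chain_new_element:
  fixes C :: "'a set set"
  assumes "finite C" and chain: "\<And>X Y. X \<in> C \<Longrightarrow> Y \<in> C \<Longrightarrow> X \<subseteq> Y \<or> Y \<subseteq> X"
    and "X \<in> C" "X \<noteq> {}"
  obtains x where "x \<in> X" "{Y \<in> C. x \<notin> Y} = {Y \<in> C. Y \<subset> X}"
proof -
  have "\<exists>x\<in>X. \<forall>Y\<in>{Y \<in> C. Y \<subset> X}. x \<notin> Y"
  proof (cases "{Y \<in> C. Y \<subset> X} = {}")
    case True
    with \<open>X \<noteq> {}\<close> show ?thesis by blast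
  next
    case False
    have "finite {Y \<in> C. Y \<subset> X}" using assms(1) by simp
    from finite_has_maximal[OF this False] obtain M
      where M: "M \<in> C" "M \<subset> X" and max: "\<And>Y. Y \<in> C \<Longrightarrow> Y \<subset> X \<Longrightarrow> M \<subseteq> Y \<Longrightarrow> M = Y"
      by auto
    then have "Y \<subseteq> M" if "Y \<in> C" "Y \<subset> X" for Y
      using chain[OF that(1) M(1)] max[OF that] by blast
    then show ?thesis using M(2) by blast
  qed
  then obtain x where x: "x \<in> X" "\<And>Y. Y \<in> C \<Longrightarrow> Y \<subset> X \<Longrightarrow> x \<notin> Y" by blast
  have "Y \<subset> X" if "Y \<in> C" "x \<notin> Y" for Y
    using chain[OF that(1) \<open>X \<in> C\<close>] x(1) that(2) by blast
  with x have "{Y \<in> C. x \<notin> Y} = {Y \<in> C. Y \<subset> X}" by blast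
  with x(1) show thesis by (rule that)
qed

text \<open>Rows and columns of a block use the same number of levels, since each row type contains
  a column that lies in no smaller type.\<close>

lemma nested_blocks_stair_mat:
  assumes A: "A \<in> carrier_mat n k" "zero_one_mat A" and "nested_blocks s A \<beta> \<gamma>"
  shows "\<exists>m f g. (\<forall>c<s. 0 < m c) \<and> labelling n s m f \<and> labelling k s m g \<and> A = stair_mat n k f g"
proof -
  have dim: "dim_row A = n" "dim_col A = k" using A by auto
  have \<beta>: "\<And>i. i < n \<Longrightarrow> \<beta> i < s" and \<gamma>: "\<And>j. j < k \<Longrightarrow> \<gamma> j < s"
    and eq: "\<And>i j. i < n \<Longrightarrow> j < k \<Longrightarrow> A $$ (i, j) \<noteq> 0 \<Longrightarrow> \<beta> i = \<gamma> j"
    and nested: "\<And>i i'. i < n \<Longrightarrow> i' < n \<Longrightarrow> \<beta> i = \<beta> i' \<Longrightarrow>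
        (\<forall>j<k. A $$ (i, j) \<noteq> 0 \<longrightarrow> A $$ (i', j) \<noteq> 0) \<or>
        (\<forall>j<k. A $$ (i', j) \<noteq> 0 \<longrightarrow> A $$ (i, j) \<noteq> 0)"
    and ex: "\<And>c. c < s \<Longrightarrow> \<exists>i<n. \<exists>j<k. A $$ (i, j) \<noteq> 0 \<and> \<beta> i = c"
    using assms(3) unfolding nested_blocks_def dim by simp_all
  define R where "R i = {j. j < k \<and> A $$ (i, j) \<noteq> 0}" for i
  \<comment> \<open>The empty support is excluded: zero rows will be labelled \<open>None\<close>,
    although \<open>\<beta>\<close> assigns them a block.\<close>
  define C where "C c = {X. \<exists>i<n. \<beta> i = c \<and> X = R i \<and> X \<noteq> {}}" for c
  have fin: "finite (C c)" for c
    by (rule finite_subset[of _ "R ` {..<n}"]) (auto simp: C_def)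
  have chain: "X \<subseteq> Y \<or> Y \<subseteq> X" if "X \<in> C c" "Y \<in> C c" for X Y c
  proof -
    obtain i i' where i: "i < n" "\<beta> i = c" "X = R i" and i': "i' < n" "\<beta> i' = c" "Y = R i'"
      using \<open>X \<in> C c\<close> \<open>Y \<in> C c\<close> unfolding C_def by blast
    have "\<beta> i = \<beta> i'" using i i' by simp
    from nested[OF i(1) i'(1) this] show ?thesis
      unfolding i(3) i'(3) R_def by blast
  qed
  have rank: "bij_betw (\<lambda>X. card {Y \<in> C c. Y \<subset> X}) (C c) {..<card (C c)}" for c
    by (rule finite_chain_rank[OF fin chain])
  have R_in_C: "R i \<in> C (\<beta> i)" if "i < n" "R i \<noteq> {}" for i
    using that by (auto simp: C_def)
  \<comment> \<open>The row types of a component form a chain; the level of a row is its rank in the chain, and the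
    level of a column is the number of row types of its component that avoid it.\<close>
  define m where "m c = card (C c)" for c
  define level where "level c X = card {Y \<in> C c. Y \<subset> X}" for c X
  define colevel where "colevel c j = card {Y \<in> C c. j \<notin> Y}" for c j
  define f where "f = restrict (\<lambda>i. if R i = {} then None else Some (\<beta> i, level (\<beta> i) (R i))) {..<n}"
  define g where "g = restrict (\<lambda>j. if \<exists>i<n. j \<in> R i then Some (\<gamma> j, colevel (\<gamma> j) j) else None) {..<k}"
  have m: "0 < m c" if c: "c < s" for c
  proof -
    obtain i j where "i < n" "j < k" "A $$ (i, j) \<noteq> 0" "\<beta> i = c"
      using ex[OF c] by blast
    then have "R i \<in> C c"
      using R_in_C[of i] by (auto simp: R_def)
    then show ?thesis
      using fin by (auto simp: m_def card_gt_0_iff)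
  qed
  have level_less: "level c X < m c" if "X \<in> C c" for c X
    using bij_betw_apply[OF rank that] by (simp add: level_def m_def)
  have level_ex: "\<exists>X\<in>C c. level c X = l" if "l < m c" for c l
    using that bij_betw_imp_surj_on[OF rank, of c] unfolding level_def m_def
    by (metis (no_types, lifting) imageE lessThan_iff)
  have R_eq: "\<beta> i = \<gamma> j" if "i < n" "j \<in> R i" for i j
    using that eq by (simp add: R_def)
  have f: "labelling n s m f"
    unfolding labelling_def
  proof
    show "f \<in> {..<n} \<rightarrow>\<^sub>E insert None (Some ` labels s m)"
      using \<beta> level_less R_in_C by (auto simp: f_def)
    show "Some ` labels s m \<subseteq> f ` {..<n}"
    proof clarify
      fix c l assume "(c, l) \<in> labels s m"
      then obtain X where X: "X \<in> C c" "level c X = l"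
        using level_ex[of l c] by auto
      then obtain i where "i < n" "\<beta> i = c" "X = R i" "R i \<noteq> {}"
        by (auto simp: C_def)
      with X have "f i = Some (c, l)" by (simp add: f_def)
      with \<open>i < n\<close> show "Some (c, l) \<in> f ` {..<n}" by force
    qed
  qed
  have g: "labelling k s m g"
    unfolding labelling_def
  proof
    show "g \<in> {..<k} \<rightarrow>\<^sub>E insert None (Some ` labels s m)"
      unfolding g_def
    proof (rule restrict_PiE_iff[THEN iffD2], rule ballI)
      fix j assume "j \<in> {..<k}"
      show "(if \<exists>i<n. j \<in> R i then Some (\<gamma> j, colevel (\<gamma> j) j) else None)
          \<in> insert None (Some ` labels s m)"
      proof (cases "\<exists>i<n. j \<in> R i")
        case True
        then obtain i where i: "i < n" "j \<in> R i" by blast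
        then have "R i \<in> C (\<gamma> j)"
          using R_in_C[of i] R_eq[OF i] by auto
        \<comment> \<open>The type \<open>R i\<close> contains \<open>j\<close>, so the types
          avoiding \<open>j\<close> form a proper subset of the chain.\<close>
        with i have "colevel (\<gamma> j) j < m (\<gamma> j)"
          unfolding colevel_def m_def by (intro psubset_card_mono fin) auto
        with True \<gamma> \<open>j \<in> {..<k}\<close> show ?thesis by simp
      qed auto
    qed
    show "Some ` labels s m \<subseteq> g ` {..<k}"
    proof clarify
      fix c l assume "(c, l) \<in> labels s m"
      then obtain X where X: "X \<in> C c" "level c X = l"
        using level_ex[of l c] by auto
      then obtain i where i: "i < n" "\<beta> i = c" "X = R i" "X \<noteq> {}"
        by (auto simp: C_def)
      obtain j where j: "j \<in> X" "{Y \<in> C c. j \<notin> Y} = {Y \<in> C c. Y \<subset> X}"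
        by (rule finite_chain_new_element[OF fin chain X(1) i(4)])
      then have "\<gamma> j = c" "j < k"
        using R_eq[of i j] i by (auto simp: R_def)
      then have "g j = Some (c, l)"
        using i j X(2) by (auto simp: g_def colevel_def level_def)
      with \<open>j < k\<close> show "Some (c, l) \<in> g ` {..<k}" by force
    qed
  qed
  have "A = stair_mat n k f g"
  proof (rule eq_matI)
    fix i j assume "i < dim_row (stair_mat n k f g)" "j < dim_col (stair_mat n k f g)"
    then have ij: "i < n" "j < k" by simp_all
    have "A $$ (i, j) = (if j \<in> R i then 1 else 0)"
      using A(2)[unfolded zero_one_mat_iff dim, rule_format, OF ij] ij by (auto simp: R_def)
    also have "\<dots> = entry (f i) (g j)"
    proof (cases "j \<in> R i")
      case True
      then have "R i \<noteq> {}" by blast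
      have "colevel (\<gamma> j) j \<le> level (\<gamma> j) (R i)"
        unfolding colevel_def level_def
      proof (rule card_mono)
        \<comment> \<open>By comparability, a type that avoids an element of \<open>R i\<close> lies
          properly below \<open>R i\<close>.\<close>
        show "{Y \<in> C (\<gamma> j). j \<notin> Y} \<subseteq> {Y \<in> C (\<gamma> j). Y \<subset> R i}"
          using chain[of _ "\<gamma> j" "R i"] R_in_C[OF ij(1) \<open>R i \<noteq> {}\<close>] R_eq[OF ij(1) True] True by auto
      qed (simp add: fin)
      then show ?thesis
        using True \<open>R i \<noteq> {}\<close> ij R_eq[OF ij(1) True] by (auto simp: f_def g_def)
    next
      case False
      have "level (\<beta> i) (R i) < colevel (\<gamma> j) j" if "\<beta> i = \<gamma> j" "R i \<noteq> {}"
        unfolding colevel_def level_def that(1)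
      proof (rule psubset_card_mono)
        \<comment> \<open>All proper subsets of \<open>R i\<close> avoid \<open>j\<close>, and so
          does \<open>R i\<close> itself, which makes the inclusion strict.\<close>
        show "{Y \<in> C (\<gamma> j). Y \<subset> R i} \<subset> {Y \<in> C (\<gamma> j). j \<notin> Y}"
          using R_in_C[OF ij(1) that(2)] that(1) False by auto
      qed (simp add: fin)
      moreover have "\<beta> i = \<gamma> j \<and> R i \<noteq> {} \<and> colevel (\<gamma> j) j \<le> level (\<beta> i) (R i)"
        if "entry (f i) (g j) = 1"
        using that ij by (auto simp: entry_eq_Suc_0_iff f_def g_def split: if_splits)
      ultimately have "entry (f i) (g j) \<noteq> 1"
        using leD by blast
      with False show ?thesis
        using entry_cases[of "f i" "g j"] by simp
    qed
    finally show "A $$ (i, j) = stair_mat n k f g $$ (i, j)"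
      using ij by simp
  qed (use dim in simp_all)
  with m f g show ?thesis by blast
qed

text \<open>The block structure of the diagonal matrix is pulled back to \<open>A\<close> along the
  inverse permutations, so that the number of components is the number of blocks.\<close>

lemma lonesum_decomposition_stair_mat:
  assumes "lonesum_decomposition Ls A" "zero_one_mat A" "A \<in> carrier_mat n k"
  shows "\<exists>m f g. (\<forall>c<length Ls. 0 < m c) \<and> labelling n (length Ls) m f \<and>
    labelling k (length Ls) m g \<and> A = stair_mat n k f g"
proof -
  have dim: "dim_row A = n" "dim_col A = k" using assms(3) by auto
  have Ls: "\<And>L. L \<in> set Ls \<Longrightarrow> lonesum_mat L \<and> \<not> all_zero_mat L"
    using assms(1) by (simp add: lonesum_decomposition_def)
  obtain p q where p: "p permutes {..<n}" and q: "q permutes {..<k}"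
    and D: "permute_mat p q A = diag_block_mat Ls"
    using assms(1) unfolding lonesum_decomposition_def dim by blast
  obtain \<beta> \<gamma> where nb: "nested_blocks (length Ls) (diag_block_mat Ls) \<beta> \<gamma>"
    using nested_blocks_diag_block_mat[OF Ls] by blast
  let ?p = "inv_into UNIV p" and ?q = "inv_into UNIV q"
  have dimD: "dim_row (diag_block_mat Ls) = n" "dim_col (diag_block_mat Ls) = k"
    unfolding D[symmetric] by (simp_all add: permute_mat_def dim)
  have less: "p i < n \<longleftrightarrow> i < n" "?p i < n \<longleftrightarrow> i < n" "q i < k \<longleftrightarrow> i < k" "?q i < k \<longleftrightarrow> i < k" for i
    using permutes_in_image[OF p] permutes_in_image[OF permutes_inv[OF p]]
      permutes_in_image[OF q] permutes_in_image[OF permutes_inv[OF q]] by auto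
  have inv: "p (?p i) = i" "?p (p i) = i" "q (?q i) = i" "?q (q i) = i" for i
    using permutes_inverses[OF p] permutes_inverses[OF q] by auto
  have idx: "diag_block_mat Ls $$ (?p i, ?q j) = A $$ (i, j)" if "i < n" "j < k" for i j
    unfolding D[symmetric] using that by (simp add: permute_mat_def dim less inv)
  \<comment> \<open>Quantification over columns is reindexed by the bijection \<open>?q\<close>,
    since nestedness compares whole rows.\<close>
  have all_q: "(\<forall>j<k. P j) \<longleftrightarrow> (\<forall>j<k. P (?q j))" for P
    using less inv by metis
  have "nested_blocks (length Ls) A (\<beta> \<circ> ?p) (\<gamma> \<circ> ?q)"
    unfolding nested_blocks_def dim comp_apply
  proof (intro conjI allI impI)
    note nb' = nb[unfolded nested_blocks_def dimD]
    show "\<beta> (?p i) < length Ls" if "i < n" for i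
      using nb' that by (simp add: less)
    show "\<gamma> (?q j) < length Ls" if "j < k" for j
      using nb' that by (simp add: less)
    show "\<beta> (?p i) = \<gamma> (?q j)" if "i < n" "j < k" "A $$ (i, j) \<noteq> 0" for i j
    proof -
      have "\<forall>i<n. \<forall>j<k. diag_block_mat Ls $$ (i, j) \<noteq> 0 \<longrightarrow> \<beta> i = \<gamma> j"
        using nb' by blast
      then show ?thesis using that less idx by metis
    qed
    show "(\<forall>j<k. A $$ (i, j) \<noteq> 0 \<longrightarrow> A $$ (i', j) \<noteq> 0) \<or> (\<forall>j<k. A $$ (i', j) \<noteq> 0 \<longrightarrow> A $$ (i, j) \<noteq> 0)"
      if i: "i < n" "i' < n" and "\<beta> (?p i) = \<beta> (?p i')" for i i'
    proof -
      have "(\<forall>j<k. diag_block_mat Ls $$ (?p i, j) \<noteq> 0 \<longrightarrow> diag_block_mat Ls $$ (?p i', j) \<noteq> 0) \<or>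
          (\<forall>j<k. diag_block_mat Ls $$ (?p i', j) \<noteq> 0 \<longrightarrow> diag_block_mat Ls $$ (?p i, j) \<noteq> 0)"
        using nb' that by (simp add: less)
      then show ?thesis
        by (subst (asm) (1 2) all_q) (simp add: idx i)
    qed
    show "\<exists>i<n. \<exists>j<k. A $$ (i, j) \<noteq> 0 \<and> \<beta> (?p i) = c" if c: "c < length Ls" for c
    proof -
      obtain i j where ij: "i < n" "j < k" "diag_block_mat Ls $$ (i, j) \<noteq> 0" "\<beta> i = c"
        using nb' c by blast
      then show ?thesis
        using idx[of "p i" "q j"]
        by (intro exI[of _ "p i"] exI[of _ "q j"] conjI) (simp_all add: less inv)
    qed
  qed
  then show ?thesis
    by (rule nested_blocks_stair_mat[OF assms(3,2)])
qed

section \<open>Lonesum decomposable matrices\<close>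

text \<open>Grouping the indices below \<open>n\<close> by \<open>\<beta>\<close> lists each of them
  exactly once; the list is then read as a permutation.\<close>

lemma concat_filter_permutes:
  fixes \<beta> :: "nat \<Rightarrow> nat"
  assumes "\<And>i. i < n \<Longrightarrow> \<beta> i < r"
  defines "xs \<equiv> concat (map (\<lambda>c. filter (\<lambda>i. \<beta> i = c) [0..<n]) [0..<r])"
  shows "length xs = n" and "\<exists>p. p permutes {..<n} \<and> (\<forall>i<n. p i = xs ! i)"
proof -
  have dist: "distinct (concat (map (\<lambda>c. filter (\<lambda>i. \<beta> i = c) [0..<n]) cs))" if "distinct cs" for cs
    using that by (induction cs) auto
  have set: "set xs = {..<n}"
    using assms(1) by (auto simp: xs_def)
  have "distinct xs"
    unfolding xs_def by (rule dist) simp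
  then show len: "length xs = n"
    using distinct_card[of xs] set by simp
  define p where "p i = (if i < n then xs ! i else i)" for i
  have "bij_betw ((!) xs) {..<n} {..<n}"
    by (rule bij_betw_nth) (use \<open>distinct xs\<close> len set in auto)
  then have "bij_betw p {..<n} {..<n}"
    using bij_betw_cong[of "{..<n}" p "(!) xs" "{..<n}"] by (simp add: p_def)
  then have "p permutes {..<n}"
    by (rule bij_imp_permutes) (simp add: p_def)
  then show "\<exists>p. p permutes {..<n} \<and> (\<forall>i<n. p i = xs ! i)"
    by (auto simp: p_def)
qed

text \<open>Inside one component an entry is 1 iff the column level is at most the row level, so
  \<open>lonesum_threshold\<close> applies. The bound \<open>b\<close> on row levels leaves room for
  a threshold above all rows, to be used for zero columns.\<close>

lemma lonesum_stair_block:
  assumes xs: "\<And>x l c'. x \<in> set xs \<Longrightarrow> f x = Some (c', l) \<Longrightarrow> c' = c \<and> l < b"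
    and ys: "\<And>y l c'. y \<in> set ys \<Longrightarrow> g y = Some (c', l) \<Longrightarrow> c' = c"
  shows "lonesum_mat (list_mat (\<lambda>x y. entry (f x) (g y)) xs ys)"
proof (rule lonesum_threshold)
  show "zero_one_mat (list_mat (\<lambda>x y. entry (f x) (g y)) xs ys)"
    using entry_cases by (simp add: zero_one_mat_iff del: One_nat_def)
  define u where "u x = (case f x of None \<Rightarrow> 0 | Some (_, l) \<Rightarrow> int l + 1)" for x
  \<comment> \<open>Zero rows of the block lie below, zero columns above all thresholds.\<close>
  define v where "v y = (case g y of None \<Rightarrow> int b + 1 | Some (_, l) \<Rightarrow> int l + 1)" for y
  fix i j
  assume "i < dim_row (list_mat (\<lambda>x y. entry (f x) (g y)) xs ys)"
    "j < dim_col (list_mat (\<lambda>x y. entry (f x) (g y)) xs ys)"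
  then have ij: "i < length xs" "j < length ys" by simp_all
  have "entry (f x) (g y) = 1 \<longleftrightarrow> v y \<le> u x" if x: "x \<in> set xs" and y: "y \<in> set ys" for x y
  proof (cases "f x")
    case None
    then show ?thesis
      by (simp add: u_def v_def split: option.split)
  next
    case (Some z)
    obtain l where z: "z = (c, l)" "l < b"
      using xs[OF x] Some by (cases z) auto
    show ?thesis
    proof (cases "g y")
      case None
      with Some z show ?thesis by (simp add: u_def v_def)
    next
      case (Some z')
      obtain l' where "z' = (c, l')"
        using ys[OF y] Some by (cases z') auto
      with Some \<open>f x = Some z\<close> z show ?thesis by (simp add: u_def v_def)
    qed
  qed
  with ij show "list_mat (\<lambda>x y. entry (f x) (g y)) xs ys $$ (i, j) = 1 \<longleftrightarrow> v (ys ! j) \<le> u (xs ! i)"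
    by simp
qed

lemma all_zero_matD:
  assumes "all_zero_mat A" "i < dim_row A" "j < dim_col A"
  shows "A $$ (i, j) = 0"
proof -
  have "A $$ (i, j) = 0\<^sub>m (dim_row A) (dim_col A) $$ (i, j)"
    using assms(1) unfolding all_zero_mat_def by (rule arg_cong)
  with assms(2,3) show ?thesis by simp
qed

lemma list_mat_not_all_zero:
  assumes "x \<in> set xs" "y \<in> set ys" "a x y \<noteq> 0"
  shows "\<not> all_zero_mat (list_mat a xs ys)"
proof
  assume zero: "all_zero_mat (list_mat a xs ys)"
  obtain i j where "i < length xs" "xs ! i = x" "j < length ys" "ys ! j = y"
    using assms(1,2) by (auto simp: in_set_conv_nth)
  with all_zero_matD[OF zero, of i j] assms(3) show False by simp
qed

text \<open>Sorting rows and columns by component gives the blocks. The blocks must fill the whole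
  matrix, so at least one is required to absorb zero rows and columns.\<close>

lemma stair_mat_lonesum_decomposition:
  assumes m: "\<forall>c<r. 0 < m c" and f: "labelling n r m f" and g: "labelling k r m g" and "0 < r"
  shows "\<exists>Ls. length Ls = r \<and> lonesum_decomposition Ls (stair_mat n k f g)"
proof -
  \<comment> \<open>The default 0 places all zero rows and columns in the first block.\<close>
  define comp where "comp u = (case u of None \<Rightarrow> 0 | Some (c, _) \<Rightarrow> c)" for u :: "(nat \<times> nat) option"
  let ?xs = "\<lambda>c. filter (\<lambda>i. comp (f i) = c) [0..<n]"
  let ?ys = "\<lambda>c. filter (\<lambda>j. comp (g j) = c) [0..<k]"
  let ?a = "\<lambda>i j. entry (f i) (g j)"
  let ?L = "\<lambda>c. list_mat ?a (?xs c) (?ys c)"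
  let ?X = "concat (map ?xs [0..<r])" and ?Y = "concat (map ?ys [0..<r])"
  have comp_f: "comp (f i) < r" if "i < n" for i
    using labelling_bound(1)[OF f that] \<open>0 < r\<close> by (auto simp: comp_def split: option.split)
  have comp_g: "comp (g j) < r" if "j < k" for j
    using labelling_bound(1)[OF g that] \<open>0 < r\<close> by (auto simp: comp_def split: option.split)
  have len: "length ?X = n" "length ?Y = k"
    using concat_filter_permutes(1)[of n "\<lambda>i. comp (f i)" r] concat_filter_permutes(1)[of k "\<lambda>j. comp (g j)" r]
      comp_f comp_g by simp_all
  obtain p where p: "p permutes {..<n}" "\<forall>i<n. p i = ?X ! i"
    using concat_filter_permutes(2)[of n "\<lambda>i. comp (f i)" r] comp_f by auto
  obtain q where q: "q permutes {..<k}" "\<forall>j<k. q j = ?Y ! j"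
    using concat_filter_permutes(2)[of k "\<lambda>j. comp (g j)" r] comp_g by auto
  have less: "p i < n \<longleftrightarrow> i < n" "q i < k \<longleftrightarrow> i < k" for i
    using permutes_in_image[OF p(1)] permutes_in_image[OF q(1)] by auto
  have entry_comp: "comp u = comp v" if "entry u v \<noteq> 0" for u v
    using that by (cases "(u, v)" rule: entry.cases) (auto simp: comp_def split: if_splits)
  have perm: "permute_mat p q (stair_mat n k f g) = list_mat ?a ?X ?Y"
  proof (rule eq_matI)
    fix i j assume "i < dim_row (list_mat ?a ?X ?Y)" "j < dim_col (list_mat ?a ?X ?Y)"
    then have ij: "i < n" "j < k"
      unfolding dim_list_mat len .
    have "permute_mat p q (stair_mat n k f g) $$ (i, j) = ?a (p i) (q j)"
      using ij less by (simp add: permute_mat_def)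
    also have "\<dots> = list_mat ?a ?X ?Y $$ (i, j)"
      using ij p(2) q(2) by (subst index_list_mat) (simp_all only: len)
    finally show "permute_mat p q (stair_mat n k f g) $$ (i, j) = list_mat ?a ?X ?Y $$ (i, j)" .
  qed (simp_all only: dim_list_mat len, simp_all add: permute_mat_def)
  have diag: "diag_block_mat (map ?L [0..<r]) = list_mat ?a ?X ?Y"
    by (rule diag_block_list_mat) (use entry_comp in auto)
  have "lonesum_mat (?L c) \<and> \<not> all_zero_mat (?L c)" if c: "c < r" for c
  proof
    show "lonesum_mat (?L c)"
    proof (rule lonesum_stair_block)
      show "c' = c \<and> l < m c" if "x \<in> set (?xs c)" "f x = Some (c', l)" for x l c'
        using that labelling_bound(2)[OF f, of x c' l] by (auto simp: comp_def)
      show "c' = c" if "y \<in> set (?ys c)" "g y = Some (c', l)" for y l c'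
        using that by (auto simp: comp_def)
    qed
    obtain x where x: "x < n" "f x = Some (c, 0)"
      by (rule labelling_surj[OF f c m[rule_format, OF c]])
    obtain y where y: "y < k" "g y = Some (c, 0)"
      by (rule labelling_surj[OF g c m[rule_format, OF c]])
    show "\<not> all_zero_mat (?L c)"
      by (rule list_mat_not_all_zero[of x _ y]) (use x y in \<open>simp_all add: comp_def\<close>)
  qed
  then have "lonesum_decomposition (map ?L [0..<r]) (stair_mat n k f g)"
    unfolding lonesum_decomposition_def dim_stair_mat using p(1) q(1) perm diag by auto
  then show ?thesis
    by (intro exI[of _ "map ?L [0..<r]"]) simp
qed

text \<open>\<open>labelling_unique\<close> embeds the components of one labelling into those of the
  other; used in both directions it gives uniqueness of the order.\<close>

lemma labelling_order_le:
  assumes "\<forall>c<r. 0 < m c" "labelling n r m f" "labelling k r m g"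
    and "labelling n r' m' f'" "labelling k r' m' g'" "stair_mat n k f g = stair_mat n k f' g'"
  shows "r \<le> r'"
proof -
  have "entry (f i) (g j) = entry (f' i) (g' j)" if "i < n" "j < k" for i j
    using arg_cong[OF assms(6), of "\<lambda>A. A $$ (i, j)"] that by simp
  then obtain \<pi> where "inj_on \<pi> {..<r}" "\<pi> ` {..<r} \<subseteq> {..<r'}"
    using labelling_unique[OF assms(2-5)] assms(1) by metis
  then show ?thesis
    using card_inj_on_le[of \<pi> "{..<r}" "{..<r'}"] by simp
qed

text \<open>For \<open>r = 0\<close> all labels are \<open>None\<close> and the matrix is zero.
  Otherwise any decomposition into \<open>s\<close> blocks yields labellings with \<open>s\<close>
  components, and comparing both ways gives \<open>s = r\<close>.\<close>

lemma stair_mat_decomposition: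
  assumes m: "\<forall>c<r. 0 < m c" and f: "labelling n r m f" and g: "labelling k r m g"
  shows "lonesum_decomposable (stair_mat n k f g)" "decomposition_order (stair_mat n k f g) = r"
proof -
  let ?A = "stair_mat n k f g"
  have "lonesum_decomposable ?A \<and> decomposition_order ?A = r"
  proof (cases "r = 0")
    case True
    have "f i = None" if "i < n" for i
      using labelling_bound(1)[OF f that] True by (cases "f i") auto
    then have "all_zero_mat ?A"
      unfolding all_zero_mat_def by (intro eq_matI) simp_all
    then show ?thesis
      using True zero_one_stair_mat by (simp add: lonesum_decomposable_def decomposition_order_def)
  next
    case False
    then have r: "0 < r" by simp
    obtain Ls where Ls: "length Ls = r" "lonesum_decomposition Ls ?A"
      using stair_mat_lonesum_decomposition[OF m f g r] by blast
    obtain i where i: "i < n" "f i = Some (0, 0)"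
      by (rule labelling_surj[OF f r m[rule_format, OF r]])
    obtain j where j: "j < k" "g j = Some (0, 0)"
      by (rule labelling_surj[OF g r m[rule_format, OF r]])
    have "?A $$ (i, j) = 1" using i j by simp
    then have nz: "\<not> all_zero_mat ?A"
      using all_zero_matD[of ?A i j] i(1) j(1) by auto
    have "(THE r. \<exists>Ls. length Ls = r \<and> lonesum_decomposition Ls ?A) = r"
    proof (rule the_equality)
      show "\<exists>Ls. length Ls = r \<and> lonesum_decomposition Ls ?A"
        using Ls by blast
      fix s assume "\<exists>Ls. length Ls = s \<and> lonesum_decomposition Ls ?A"
      then obtain Ls' where "length Ls' = s" "lonesum_decomposition Ls' ?A" by blast
      then obtain m' f' g' where "\<forall>c<s. 0 < m' c" "labelling n s m' f'" "labelling k s m' g'"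
        "?A = stair_mat n k f' g'"
        using lonesum_decomposition_stair_mat[OF _ zero_one_stair_mat stair_mat_carrier] by metis
      then show "s = r"
        using labelling_order_le[OF m f g, of s m' f' g'] labelling_order_le[of s m' n f' k g' r m f g] f g
        by simp
    qed
    with nz Ls(2) show ?thesis
      using zero_one_stair_mat by (auto simp: lonesum_decomposable_def decomposition_order_def)
  qed
  then show "lonesum_decomposable ?A" "decomposition_order ?A = r" by simp_all
qed

text \<open>A decomposition provides labellings, and a zero matrix is labelled constantly by
  \<open>None\<close> with no components. In either case \<open>stair_mat_decomposition\<close>
  identifies the number of components with the order.\<close>

lemma lonesum_decomposable_stair_mat:
  assumes "lonesum_decomposable A" "A \<in> carrier_mat n k"
  obtains m f g where "\<forall>c<decomposition_order A. 0 < m c"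
    "labelling n (decomposition_order A) m f" "labelling k (decomposition_order A) m g"
    "A = stair_mat n k f g"
proof -
  have A: "zero_one_mat A" and "all_zero_mat A \<or> (\<exists>Ls. lonesum_decomposition Ls A)"
    using assms(1) by (simp_all add: lonesum_decomposable_def)
  then consider "all_zero_mat A" | Ls where "lonesum_decomposition Ls A" by blast
  then have "\<exists>r m f g. (\<forall>c<r. 0 < m c) \<and> labelling n r m f \<and> labelling k r m g \<and> A = stair_mat n k f g"
  proof cases
    case 1
    have "A = stair_mat n k (restrict (\<lambda>_. None) {..<n}) (restrict (\<lambda>_. None) {..<k})"
      using assms(2) all_zero_matD[OF 1] by (intro eq_matI) auto
    moreover have "labelling N 0 m (restrict (\<lambda>_. None) {..<N})" for N m
      by (auto simp: labelling_def labels_def)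
    ultimately show ?thesis
      by (metis not_less_zero)
  next
    case 2
    then show ?thesis
      using lonesum_decomposition_stair_mat[OF _ A assms(2)] by blast
  qed
  then obtain r m f g where rmfg: "\<forall>c<r. 0 < m c" "labelling n r m f" "labelling k r m g"
    "A = stair_mat n k f g" by blast
  then have "decomposition_order A = r"
    using stair_mat_decomposition(2) by blast
  with rmfg that show thesis by blast
qed

lemma lonesum_decomposable_eq_stair_mats:
  "{A \<in> carrier_mat n k. lonesum_decomposable A \<and> decomposition_order A = r \<and>
     row_multiplicities_in S1 A \<and> col_multiplicities_in S2 A} = stair_mats r S1 S2 n k"
proof (intro subset_antisym subsetI)
  fix A assume "A \<in> {A \<in> carrier_mat n k. lonesum_decomposable A \<and> decomposition_order A = r \<and>
     row_multiplicities_in S1 A \<and> col_multiplicities_in S2 A}"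
  then have A: "A \<in> carrier_mat n k" "lonesum_decomposable A" "decomposition_order A = r"
    "row_multiplicities_in S1 A" "col_multiplicities_in S2 A" by simp_all
  obtain m f g where mfg: "\<forall>c<r. 0 < m c" "labelling n r m f" "labelling k r m g"
    "A = stair_mat n k f g"
    using lonesum_decomposable_stair_mat[OF A(2,1)] unfolding A(3) by metis
  then have "(f, g) \<in> labelling_pairs r S1 S2 n k"
    using A(4,5) labelling_pairs_iff by blast
  with mfg(4) show "A \<in> stair_mats r S1 S2 n k"
    by (force simp: stair_mats_def)
next
  fix A assume "A \<in> stair_mats r S1 S2 n k"
  then obtain f g where fg: "(f, g) \<in> labelling_pairs r S1 S2 n k" "A = stair_mat n k f g"
    by (auto simp: stair_mats_def)
  then show "A \<in> {A \<in> carrier_mat n k. lonesum_decomposable A \<and> decomposition_order A = r \<and>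
     row_multiplicities_in S1 A \<and> col_multiplicities_in S2 A}"
    using stair_mat_decomposition by (auto simp: labelling_pairs_iff)
qed

section \<open>Coefficients of the two generating functions\<close>

lemma D_order_nth:
  assumes "0 \<notin> S1" "0 \<notin> S2"
  shows "of_nat (D_order r S1 S2 n k) / (fact n * fact k) =
    1 / fact r * fps_nth (fps_nth ((1 + in_x (E S1)) * (1 + in_y (E S2)) *
      (inverse (1 - in_x (E S1) * in_y (E S2)) - 1) ^ r) k) n"
proof -
  have "D_order r S1 S2 n k = card (stair_mats r S1 S2 n k)"
    unfolding D_order_def lonesum_decomposable_eq_stair_mats ..
  then show ?thesis
    unfolding card_labelling_pairs_nth[OF assms, symmetric] card_labelling_pairs_stair_mats[OF assms]
    by simp
qed

lemma labelling_order_bound: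
  assumes "\<forall>c<r. 0 < m c" "labelling n r m f"
  shows "r \<le> n"
proof -
  have "(\<lambda>c. Some (c, 0)) ` {..<r} \<subseteq> f ` {..<n}"
    using assms unfolding labelling_def by force
  then have "card ((\<lambda>c. Some (c, 0 :: nat)) ` {..<r}) \<le> card {..<n}"
    by (meson surj_card_le finite_lessThan)
  then show ?thesis
    by (simp add: card_image inj_on_def)
qed

lemma finite_stair_mats: "0 \<notin> S1 \<Longrightarrow> 0 \<notin> S2 \<Longrightarrow> finite (stair_mats r S1 S2 n k)"
  by (simp add: stair_mats_def finite_labelling_pairs)

text \<open>Every component has a column of level 0, which bounds the order by \<open>k\<close>;
  different orders give disjoint sets of matrices. The bound by \<open>k\<close> again fits the
  outer variable \<open>y\<close>.\<close>

lemma D_all_eq_sum: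
  assumes "0 \<notin> S1" "0 \<notin> S2"
  shows "D_all S1 S2 n k = (\<Sum>r\<le>k. D_order r S1 S2 n k)"
proof -
  have "{A \<in> carrier_mat n k. lonesum_decomposable A \<and>
      row_multiplicities_in S1 A \<and> col_multiplicities_in S2 A} = (\<Union>r\<le>k. stair_mats r S1 S2 n k)"
    (is "?D = _")
  proof (intro subset_antisym subsetI)
    fix A assume A: "A \<in> ?D"
    then have st: "A \<in> stair_mats (decomposition_order A) S1 S2 n k"
      unfolding lonesum_decomposable_eq_stair_mats[symmetric] by simp
    have "lonesum_decomposable A" "A \<in> carrier_mat n k"
      using A by simp_all
    then have "decomposition_order A \<le> k"
      by (rule lonesum_decomposable_stair_mat) (rule labelling_order_bound)
    with st show "A \<in> (\<Union>r\<le>k. stair_mats r S1 S2 n k)"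
      by (intro UN_I) simp_all
  qed (auto simp flip: lonesum_decomposable_eq_stair_mats)
  then show ?thesis
    unfolding D_all_def D_order_def lonesum_decomposable_eq_stair_mats
    by (simp, intro card_UN_disjoint)
      (use finite_stair_mats[OF assms] in \<open>auto simp flip: lonesum_decomposable_eq_stair_mats\<close>)
qed

theorem theorem11:
  fixes S1 S2 :: "nat set" and r :: nat
  assumes "S1 \<subseteq> {0<..}" and "S2 \<subseteq> {0<..}"
  shows "egf2 (D_order r S1 S2) =
           const2 (1 / fact r) * (1 + in_x (E S1)) * (1 + in_y (E S2)) *
             (inverse (1 - in_x (E S1) * in_y (E S2)) - 1) ^ r
       \<and> egf2 (D_all S1 S2) =
           (1 + in_x (E S1)) * (1 + in_y (E S2)) *
             fps_compose (fps_exp 1) (inverse (1 - in_x (E S1) * in_y (E S2)) - 1)"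
proof
  have S: "0 \<notin> S1" "0 \<notin> S2"
    using assms by auto
  let ?F = "(1 + in_x (E S1)) * (1 + in_y (E S2))"
  let ?H = "inverse (1 - in_x (E S1) * in_y (E S2)) - 1"
  have coeff: "fps_nth (fps_nth (egf2 (D_order r S1 S2)) k) n =
      fps_nth (fps_nth (const2 (1 / fact r) * (?F * ?H ^ r)) k) n" for r k n
    by (simp only: egf2_def fps_nth_Abs_fps D_order_nth[OF S] const2_def fps_mult_left_const_nth)
  show "egf2 (D_order r S1 S2) = const2 (1 / fact r) * (1 + in_x (E S1)) * (1 + in_y (E S2)) * ?H ^ r"
    by (intro fps_ext) (simp only: coeff mult.assoc)
  show "egf2 (D_all S1 S2) = ?F * fps_compose (fps_exp 1) ?H"
  proof (intro fps_ext)
    fix k n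
    have H0: "fps_nth ?H 0 = 0"
      by (rule nth_0_inverse_minus_1[OF S(2)])
    have "fps_nth (?F * fps_compose (fps_exp 1) ?H) k =
        (\<Sum>i\<le>k. fps_nth ?F i * (\<Sum>r\<le>k - i. fps_const (1 / fact r) * fps_nth (?H ^ r) (k - i)))"
      by (simp only: fps_mult_nth fps_compose_nth fps_nth_exp_1 atLeast0AtMost)
    also have "\<dots> = (\<Sum>i\<le>k. fps_nth ?F i * (\<Sum>r\<le>k. fps_const (1 / fact r) * fps_nth (?H ^ r) (k - i)))"
    proof (intro sum.cong refl)
      fix i assume "i \<in> {..k}"
      \<comment> \<open>\<open>?H\<close> has no term free of \<open>y\<close>, so
        \<open>?H ^ r\<close> contributes nothing to coefficient \<open>k - i\<close> when
        \<open>r > k - i\<close>. Extending to \<open>r \<le> k\<close> gives a range independent of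
        \<open>i\<close>.\<close>
      have "(\<Sum>r\<le>k - i. fps_const (1 / fact r) * fps_nth (?H ^ r) (k - i)) =
          (\<Sum>r\<le>k. fps_const (1 / fact r) * fps_nth (?H ^ r) (k - i))"
        by (intro sum.mono_neutral_left) (use startsby_zero_power_prefix[OF H0] in auto)
      then show "fps_nth ?F i * (\<Sum>r\<le>k - i. fps_const (1 / fact r) * fps_nth (?H ^ r) (k - i)) =
          fps_nth ?F i * (\<Sum>r\<le>k. fps_const (1 / fact r) * fps_nth (?H ^ r) (k - i))"
        by (simp only:)
    qed
    \<comment> \<open>After interchanging the sums, the inner one is the convolution that defines
      coefficient \<open>k\<close> of \<open>?F * ?H ^ r\<close>.\<close>
    also have "\<dots> = (\<Sum>r\<le>k. fps_const (1 / fact r) * fps_nth (?F * ?H ^ r) k)"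
      unfolding fps_mult_nth atLeast0AtMost sum_distrib_left
      by (subst sum.swap) (intro sum.cong refl mult.left_commute)
    also have "fps_nth \<dots> n = (\<Sum>r\<le>k. 1 / fact r * fps_nth (fps_nth (?F * ?H ^ r) k) n)"
      by (simp only: fps_nth_sum fps_mult_left_const_nth)
    also have "\<dots> = fps_nth (fps_nth (egf2 (D_all S1 S2)) k) n"
      by (simp only: egf2_def fps_nth_Abs_fps D_all_eq_sum[OF S] of_nat_sum sum_divide_distrib
          D_order_nth[OF S])
    finally show "fps_nth (fps_nth (egf2 (D_all S1 S2)) k) n =
        fps_nth (fps_nth (?F * fps_compose (fps_exp 1) ?H) k) n" ..
  qed
qed

end
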